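(* The number of non-zero integral friezes of Dynkin type $D_k$ is $4$ times the number of positive friezes of type $D_k$ when $k$ is even, and $2$ times the number of positive friezes of type $D_k$ when $k$ is odd.
   Context: The cluster algebra of Dynkin type $D_k$ is the coefficient-free cluster algebra (a subring, generated over $\mathbb{Z}$ by all cluster variables, of the field of rational functions in the initial variables) whose initial seed has as quiver an orientation of the Dynkin diagram $D_k$ ($k\ge 4$, the standard range for this type). A non-zero integral frieze of this type is a ring homomorphism from the cluster algebra to $\mathbb{Z}$ sending every cluster variable to a non-zero integer; equivalently, an assignment of a non-zero integer to each cluster variable such that all mutation (exchange) relations hold. A positive frieze is such a homomorphism sending every cluster variable to a positive integer. *)

theory Defs
  imports
    "HOL-Library.Poly_Mapping"
    "HOL-Library.FuncSet"
    "HOL-Computational_Algebra.Fraction_Field"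
    "HOL-Algebra.Generated_Rings"
    "HOL-Algebra.IntRing"
    "HOL-Algebra.Algebraic_Closure_Type"
begin

text \<open>
  Integer polynomials in indeterminates indexed by \<open>nat\<close> are finitely supported functions
  from monomials to coefficients; rational functions form their fraction field.  A cluster
  algebra of rank \<open>k\<close> lives in the subfield generated by the indeterminates of index \<open>< k\<close>.
\<close>

type_synonym ratfun = "((nat \<Rightarrow>\<^sub>0 nat) \<Rightarrow>\<^sub>0 int) fract"

definition indet :: "nat \<Rightarrow> ratfun" where
  "indet i = Fract (Poly_Mapping.single (Poly_Mapping.single i 1) 1) 1"

text \<open>
  The Dynkin diagram \<open>D\<^sub>k\<close> has vertices \<open>0, \<dots>, k - 1\<close>: a path \<open>0, \<dots>, k - 2\<close> together with
  an edge joining \<open>k - 3\<close> and \<open>k - 1\<close>.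
\<close>

definition dynkin_D :: "nat \<Rightarrow> nat set set" where
  "dynkin_D k = {{i, i + 1} | i. i + 1 < k - 1} \<union> {{k - 3, k - 1}}"

text \<open>A quiver without multiple arrows is the set of its arrows \<open>(source, target)\<close>.\<close>

definition orientation_of :: "nat set set \<Rightarrow> (nat \<times> nat) set \<Rightarrow> bool" where
  "orientation_of E Q \<longleftrightarrow>
     (\<forall>i j. {i, j} \<in> E \<longleftrightarrow> (i, j) \<in> Q \<or> (j, i) \<in> Q) \<and>
     (\<forall>i j. (i, j) \<in> Q \<longrightarrow> (j, i) \<notin> Q)"

text \<open>
  Exchange matrices carry the sign convention
  \<open>b\<^sub>i\<^sub>j = #(arrows i \<rightarrow> j) - #(arrows j \<rightarrow> i)\<close>.
\<close>

type_synonym exchange_matrix = "nat \<Rightarrow> nat \<Rightarrow> int"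
type_synonym seed = "(nat \<Rightarrow> ratfun) \<times> exchange_matrix"

definition exchange_matrix_of :: "(nat \<times> nat) set \<Rightarrow> exchange_matrix" where
  "exchange_matrix_of Q i j = of_bool ((i, j) \<in> Q) - of_bool ((j, i) \<in> Q)"

definition mutate_matrix :: "nat \<Rightarrow> exchange_matrix \<Rightarrow> exchange_matrix" where
  "mutate_matrix m b i j =
     (if i = m \<or> j = m then - b i j
      else b i j + max 0 (b i m) * max 0 (b m j) - max 0 (- b i m) * max 0 (- b m j))"

text \<open>
  The exponents below are \<open>[b\<^sub>i\<^sub>m]\<^sub>+\<close> and \<open>[- b\<^sub>i\<^sub>m]\<^sub>+\<close>, because \<open>nat\<close> truncates
  negative integers to \<open>0\<close>.
\<close>

definition mutate_cluster ::
  "nat \<Rightarrow> nat \<Rightarrow> exchange_matrix \<Rightarrow> (nat \<Rightarrow> ratfun) \<Rightarrow> (nat \<Rightarrow> ratfun)" where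
  "mutate_cluster k m b x =
     x(m := ((\<Prod>i<k. x i ^ nat (b i m)) + (\<Prod>i<k. x i ^ nat (- b i m))) / x m)"

inductive_set seeds :: "nat \<Rightarrow> (nat \<times> nat) set \<Rightarrow> seed set"
  for k :: nat and Q :: "(nat \<times> nat) set" where
  initial: "(indet, exchange_matrix_of Q) \<in> seeds k Q"
| mutate: "(x, b) \<in> seeds k Q \<Longrightarrow> m < k \<Longrightarrow>
             (mutate_cluster k m b x, mutate_matrix m b) \<in> seeds k Q"

definition cluster_variables :: "nat \<Rightarrow> (nat \<times> nat) set \<Rightarrow> ratfun set" where
  "cluster_variables k Q = {x i | x b i. (x, b) \<in> seeds k Q \<and> i < k}"

definition cluster_algebra :: "nat \<Rightarrow> (nat \<times> nat) set \<Rightarrow> ratfun ring" where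
  "cluster_algebra k Q =
     ring_of_type_algebra
       \<lparr>carrier := generate_ring ring_of_type_algebra (cluster_variables k Q)\<rparr>"

text \<open>
  \<open>ring_hom\<close> does not constrain a function outside the carrier; extensionality makes each
  homomorphism of the cluster algebra count exactly once.
\<close>

definition integral_homs :: "nat \<Rightarrow> (nat \<times> nat) set \<Rightarrow> (ratfun \<Rightarrow> int) set" where
  "integral_homs k Q =
     ring_hom (cluster_algebra k Q) \<Z> \<inter> extensional (carrier (cluster_algebra k Q))"

definition nonzero_friezes :: "nat \<Rightarrow> (nat \<times> nat) set \<Rightarrow> (ratfun \<Rightarrow> int) set" where
  "nonzero_friezes k Q = {f \<in> integral_homs k Q. \<forall>x \<in> cluster_variables k Q. f x \<noteq> 0}"

definition positive_friezes :: "nat \<Rightarrow> (nat \<times> nat) set \<Rightarrow> (ratfun \<Rightarrow> int) set" where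
  "positive_friezes k Q = {f \<in> integral_homs k Q. \<forall>x \<in> cluster_variables k Q. f x > 0}"

end

theory Submission
  imports Defs Complex_Main
begin

text \<open>
  The diagonal sign changes of the initial variables that respect all exchange relations are the
  vectors \<open>s\<close> modulo 2 with \<open>\<Sum>\<^sub>i s\<^sub>i b\<^sub>i\<^sub>j\<close> even for all \<open>j\<close>.  Every such sign change extends to an
  automorphism of the field of rational functions that sends each cluster variable to plus or
  minus itself, because evenness of these sums is inherited by the mutated exchange matrix.  Modulo
  2 the exchange matrix of an orientation is the adjacency matrix of the diagram, and for \<open>D\<^sub>k\<close> the
  kernel has 4 elements when \<open>k\<close> is even and 2 when \<open>k\<close> is odd (\<open>card_sign_changes_D\<close>).  The
  group of sign changes acts on the non-zero friezes, and positive friezes lie in distinct orbits,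
  which are free.  Hence the count holds as soon as every non-zero frieze can be made positive by a
  sign change, that is, as soon as the signs of its values on one cluster form a kernel vector
  (\<open>flip_frieze_bij_betw\<close>).

  The signs are found on the clusters reached by mutating all vertices again and again in
  topological order.  Along these clusters the exchange relations of \<open>D\<^sub>n\<close>, with \<open>n = k\<close>, are the
  relations between arcs of a once-punctured \<open>n\<close>-gon: boundary arcs \<open>d t l\<close> from \<open>t\<close> to \<open>t + l\<close>, and
  plain and notched arcs \<open>p t\<close>, \<open>q t\<close> from \<open>t\<close> to the puncture.  They force \<open>q\<close> to be a multiple
  \<open>\<rho> p\<close> of \<open>p\<close>, and \<open>p\<close> to be \<open>n\<close>-periodic and a solution of the linear recurrence that governs
  \<open>d\<close>.  Therefore \<open>d t l = p t * p (t + l) * (x (t + l) - x t)\<close> for the points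
  \<open>x t = (\<Sum>l<t. 1 / (p l * p (l + 1)))\<close> of the real line, and \<open>x (t + n) = x t + \<rho>\<close>.  All these
  products are non-zero integers, so the points form a path of Farey neighbours that never returns
  to a point already visited within \<open>n\<close> steps.  Edges of the Farey graph do not cross; if the path
  turned back at some point it would be trapped under an edge, while it has to arrive at the
  translate by \<open>\<rho>\<close>, which is at least one edge length away (\<open>x_monotone\<close>).  So \<open>x\<close> is monotone, and
  the sign of every \<open>p t\<close>, \<open>q t\<close>, \<open>d t l\<close> follows (\<open>sign_pattern\<close>): either everything can be made
  positive by a common sign of \<open>p\<close> and \<open>q\<close>, or signs alternate and then \<open>n\<close> is even.

  Finiteness comes from the same picture.  For a positive frieze, telescoping over one period gives
  \<open>(\<Sum>i<n. 1 / (p i * q (i + 1))) = 1\<close>, and an equation of this kind between unit fractions has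
  finitely many solutions (\<open>unit_fraction_sum_bound\<close>), so all values on a late cluster are bounded;
  and a frieze is determined by its values on any single cluster.
\<close>

section \<open>Sums of unit fractions\<close>

text \<open>
  A smallest denominator is at most \<open>card I / s\<close>, which leaves finitely many choices for it; the
  remaining denominators are bounded by induction, which is why \<open>s\<close> has to be arbitrary.
\<close>

lemma unit_fraction_sum_bound:
  fixes I :: "'a set" and s :: real
  assumes "finite I"
  shows "\<exists>B. \<forall>t :: 'a \<Rightarrow> int. (\<forall>i\<in>I. 0 < t i) \<longrightarrow> (\<Sum>i\<in>I. 1 / real_of_int (t i)) = s
           \<longrightarrow> (\<forall>i\<in>I. t i \<le> B)"
  using assms
proof (induction "card I" arbitrary: I s)
  case 0
  then show ?case by auto
next
  case (Suc n)
  have fin: "finite I" and ne: "I \<noteq> {}" using Suc by auto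
  have "\<exists>B. \<forall>t :: 'a \<Rightarrow> int. (\<forall>i\<in>I - {j}. 0 < t i) \<longrightarrow>
      (\<Sum>i\<in>I - {j}. 1 / real_of_int (t i)) = s - 1 / real_of_int c \<longrightarrow> (\<forall>i\<in>I - {j}. t i \<le> B)"
    if "j \<in> I" for j c
    using Suc.hyps(1)[of "I - {j}" "s - 1 / real_of_int c"] Suc.hyps(2) fin that by simp
  then obtain B where B: "\<And>j c t i. j \<in> I \<Longrightarrow> (\<forall>i\<in>I - {j}. 0 < t i) \<Longrightarrow>
      (\<Sum>i\<in>I - {j}. 1 / real_of_int (t i)) = s - 1 / real_of_int c \<Longrightarrow> i \<in> I - {j} \<Longrightarrow> t i \<le> B j c"
    by metis
  define N where "N = \<lfloor>real (card I) / s\<rfloor>"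
  define C where "C = Max (insert N ((\<lambda>(j, c). B j c) ` (I \<times> {1..N})))"
  have C: "N \<le> C" "\<And>j c. j \<in> I \<Longrightarrow> c \<in> {1..N} \<Longrightarrow> B j c \<le> C"
    unfolding C_def using fin by (auto intro!: Max_ge)
  have "t i \<le> C" if pos: "\<forall>i\<in>I. 0 < t i" and sum: "(\<Sum>i\<in>I. 1 / real_of_int (t i)) = s"
    and i: "i \<in> I" for t :: "'a \<Rightarrow> int" and i
  proof -
    obtain j where j: "j \<in> I" "\<And>i. i \<in> I \<Longrightarrow> t j \<le> t i"
      using ex_min_if_finite[of "t ` I"] fin ne by (force simp: not_less)
    have tj: "0 < t j" using pos j by blast
    have spos: "0 < s" using sum[symmetric] pos ne fin by (auto intro!: sum_pos)
    have "s \<le> (\<Sum>i\<in>I. 1 / real_of_int (t j))"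
      unfolding sum[symmetric] using j pos tj by (intro sum_mono) (auto intro!: divide_left_mono)
    then have "s \<le> real (card I) / real_of_int (t j)" by simp
    then have "real_of_int (t j) \<le> real (card I) / s"
      using tj spos by (simp add: field_simps)
    then have tjN: "t j \<le> N" unfolding N_def by (simp add: le_floor_iff)
    show ?thesis
    proof (cases "i = j")
      case True
      then show ?thesis using tjN C(1) by simp
    next
      case False
      have "(\<Sum>i\<in>I - {j}. 1 / real_of_int (t i)) = s - 1 / real_of_int (t j)"
        using sum fin j(1) by (simp add: sum_diff1)
      then have "t i \<le> B j (t j)" using B[OF j(1), of t "t j" i] pos i False by auto
      moreover have "B j (t j) \<le> C" using C(2)[OF j(1), of "t j"] tj tjN by auto
      ultimately show ?thesis by (rule order_trans)
    qed
  qed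
  then show ?case by blast
qed

section \<open>Paths in the Farey graph\<close>

text \<open>
  For reduced fractions \<open>y i\<close> with denominators \<open>u i\<close>, the number \<open>\<bar>u i * u j * (y j - y i)\<bar>\<close> is a
  determinant, and it is 1 exactly for the edges of the Farey graph.  Edges do not cross, since
  Ptolemy's relation would write 1 as a sum of two products of numbers that are at least 1.  Hence a
  path that steps into the open interval between the ends of its first edge, and never meets these
  ends again, cannot leave the interval.
\<close>

lemma Farey_path_trapped:
  fixes u y :: "nat \<Rightarrow> real"
  assumes n: "2 \<le> n"
    and edge: "\<And>i. i < n \<Longrightarrow> \<bar>u i * u (Suc i) * (y (Suc i) - y i)\<bar> = 1"
    and far: "\<And>i j. i < j \<Longrightarrow> j \<le> n \<Longrightarrow> 1 \<le> \<bar>u i * u j * (y j - y i)\<bar>"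
    and turn: "(y 0 < y 2 \<and> y 2 < y 1) \<or> (y 1 < y 2 \<and> y 2 < y 0)"
  shows "(y 0 < y n \<and> y n < y 1) \<or> (y 1 < y n \<and> y n < y 0)"
proof -
  define D where "D i j = \<bar>u i * u j * (y j - y i)\<bar>" for i j
  have D1: "1 \<le> D i j" if "i < j" "j \<le> n" for i j using far[OF that] by (simp add: D_def)
  have De: "D i (Suc i) = 1" if "i < n" for i using edge[OF that] by (simp add: D_def)
  have D_eq: "D i j = \<bar>u i\<bar> * \<bar>u j\<bar> * \<bar>y j - y i\<bar>" for i j by (simp add: D_def abs_mult)
  have ne: "y i \<noteq> y j" if "i < j" "j \<le> n" for i j using far[OF that] by auto
  let ?in = "\<lambda>k. (y 0 < y k \<and> y k < y 1) \<or> (y 1 < y k \<and> y k < y 0)"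
  have "2 \<le> k \<Longrightarrow> k \<le> n \<Longrightarrow> ?in k" for k
  proof (induction k rule: dec_induct)
    case base
    show ?case by (rule turn)
  next
    case (step k)
    have k: "2 \<le> k" "Suc k \<le> n" "?in k" using step by auto
    show ?case
    proof (rule ccontr)
      assume out: "\<not> ?in (Suc k)"
      have "y (Suc k) \<noteq> y 0" "y (Suc k) \<noteq> y 1"
        using ne[of 0 "Suc k"] ne[of 1 "Suc k"] k by auto
      \<comment> \<open>The chords from \<open>y 0\<close> to \<open>y 1\<close> and from \<open>y k\<close> to \<open>y (Suc k)\<close> cross.\<close>
      then have "\<bar>y 1 - y 0\<bar> * \<bar>y (Suc k) - y k\<bar> =
          \<bar>y k - y 0\<bar> * \<bar>y (Suc k) - y 1\<bar> + \<bar>y k - y 1\<bar> * \<bar>y (Suc k) - y 0\<bar>"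
        using k(3) out by (auto simp: abs_if algebra_simps)
      then have *: "\<bar>y k - y 0\<bar> * \<bar>y (Suc k) - y 1\<bar> + \<bar>y k - y 1\<bar> * \<bar>y (Suc k) - y 0\<bar>
          = \<bar>y 1 - y 0\<bar> * \<bar>y (Suc k) - y k\<bar>" ..
      let ?w = "\<bar>u 0\<bar> * \<bar>u 1\<bar> * \<bar>u k\<bar> * \<bar>u (Suc k)\<bar>"
      have "D 0 k * D 1 (Suc k) + D 1 k * D 0 (Suc k) =
          ?w * (\<bar>y k - y 0\<bar> * \<bar>y (Suc k) - y 1\<bar> + \<bar>y k - y 1\<bar> * \<bar>y (Suc k) - y 0\<bar>)"
        by (simp add: D_eq algebra_simps)
      also have "\<dots> = D 0 1 * D k (Suc k)" unfolding * by (simp add: D_eq algebra_simps)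
      also have "\<dots> = 1" using De[of 0] De[of k] k by simp
      finally have "D 0 k * D 1 (Suc k) + D 1 k * D 0 (Suc k) = 1" .
      moreover have "1 * 1 \<le> D 0 k * D 1 (Suc k)" "1 * 1 \<le> D 1 k * D 0 (Suc k)"
        using mult_mono[of 1 "D 0 k" 1 "D 1 (Suc k)"] mult_mono[of 1 "D 1 k" 1 "D 0 (Suc k)"]
          D1[of 0 k] D1[of 1 "Suc k"] D1[of 1 k] D1[of 0 "Suc k"] k by auto
      ultimately show False by linarith
    qed
  qed
  then show ?thesis using n by blast
qed

section \<open>Frieze patterns of type D\<close>

text \<open>
  In a once-punctured \<open>n\<close>-gon, \<open>d t l\<close> is the value at the arc from vertex \<open>t\<close> to vertex \<open>t + l\<close>,
  and \<open>p t\<close>, \<open>q t\<close> are the values at the plain and notched arcs from \<open>t\<close> to the puncture.  The loop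
  at \<open>t\<close> around the puncture has value \<open>d t n = p t * q t\<close>.  Vertices are counted by natural numbers
  rather than modulo \<open>n\<close>, because periodicity is a consequence of the relations.
\<close>

locale D_frieze =
  fixes n :: nat and d :: "nat \<Rightarrow> nat \<Rightarrow> int" and p q :: "nat \<Rightarrow> int"
  assumes n: "3 \<le> n"
    and d_0: "d t 0 = 0" and d_1: "d t (Suc 0) = 1" and d_n: "d t n = p t * q t"
    and mesh: "0 < l \<Longrightarrow> l < n \<Longrightarrow> d t l * d (Suc t) l = 1 + d (Suc t) (l - 1) * d t (Suc l)"
    and cross: "p t * q (Suc t) = 1 + d (Suc t) (n - 1)" "q t * p (Suc t) = 1 + d (Suc t) (n - 1)"
    and d_nz: "0 < l \<Longrightarrow> l < n \<Longrightarrow> d t l \<noteq> 0" and p_nz: "p t \<noteq> 0" and q_nz: "q t \<noteq> 0"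
begin

text \<open>
  The argument of Conway and Coxeter: subtracting two neighbouring mesh relations shows that the
  ratio of the two sides does not depend on \<open>l\<close>.
\<close>

lemma d_recurrence:
  "Suc (Suc l) \<le> n \<Longrightarrow> d t (Suc (Suc l)) + d (Suc (Suc t)) l = d t (Suc (Suc 0)) * d (Suc t) (Suc l)"
proof (induction l)
  case 0
  then show ?case by (simp add: d_0 d_1)
next
  case (Suc l)
  have 1: "d t (Suc (Suc l)) * d (Suc t) (Suc (Suc l)) = 1 + d (Suc t) (Suc l) * d t (Suc (Suc (Suc l)))"
    using mesh[of "Suc (Suc l)" t] Suc.prems by simp
  have 2: "d (Suc t) (Suc l) * d (Suc (Suc t)) (Suc l) = 1 + d (Suc (Suc t)) l * d (Suc t) (Suc (Suc l))"
    using mesh[of "Suc l" "Suc t"] Suc.prems by simp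
  have "d (Suc t) (Suc l) * (d t (Suc (Suc (Suc l))) + d (Suc (Suc t)) (Suc l))
      = d (Suc t) (Suc (Suc l)) * (d t (Suc (Suc l)) + d (Suc (Suc t)) l)"
    using 1 2 by (simp add: algebra_simps)
  also have "\<dots> = d (Suc t) (Suc l) * (d t (Suc (Suc 0)) * d (Suc t) (Suc (Suc l)))"
    using Suc by simp
  finally show ?case using d_nz[of "Suc l" "Suc t"] Suc.prems by simp
qed

text \<open>
  The recurrence for \<open>d\<close> at the full length \<open>n\<close>, multiplied by \<open>p (Suc t) * q (Suc t)\<close>, involves only
  \<open>p\<close>, \<open>q\<close> and \<open>d (Suc (Suc t)) (n - 2)\<close>.  A mesh relation expresses the latter by \<open>p\<close> and \<open>q\<close>, and
  then a common factor cancels.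
\<close>

lemma p_recurrence: "d t (Suc (Suc 0)) * p (Suc t) = p t + p (Suc (Suc t))"
proof -
  obtain m where m: "n = Suc (Suc (Suc m))" using n that[of "n - 3"] by simp
  define r where "r = p t * q (Suc t) - 1"
  have r: "d (Suc t) (Suc (Suc m)) = r" "r \<noteq> 0"
    using cross(1)[of t] d_nz[of "Suc (Suc m)" "Suc t"] m by (simp_all add: r_def)
  have qp: "q t * p (Suc t) = r + 1" "q (Suc t) * p (Suc (Suc t)) = p (Suc t) * q (Suc (Suc t))"
    "p t * q (Suc t) = r + 1"
    using cross[of t] cross[of "Suc t"] r m by (simp_all add: r_def)
  have dn: "d (Suc (Suc t)) (Suc (Suc m)) = p (Suc t) * q (Suc (Suc t)) - 1"
    using cross(1)[of "Suc t"] m by simp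
  have rec: "p t * q t + d (Suc (Suc t)) (Suc m) = d t (Suc (Suc 0)) * r"
    using d_recurrence[of "Suc m" t] m d_n[of t] r by simp
  have me: "r * (p (Suc t) * q (Suc (Suc t)) - 1) =
      1 + d (Suc (Suc t)) (Suc m) * (p (Suc t) * q (Suc t))"
    using mesh[of "Suc (Suc m)" "Suc t"] m dn r d_n[of "Suc t"] by simp
  have "(q (Suc t) * r) * (d t (Suc (Suc 0)) * p (Suc t))
      = p (Suc t) * q (Suc t) * (p t * q t + d (Suc (Suc t)) (Suc m))"
    by (simp add: rec algebra_simps)
  also have "\<dots> = (q t * p (Suc t)) * (p t * q (Suc t)) +
      (r * (p (Suc t) * q (Suc (Suc t)) - 1) - 1)"
    unfolding me by (simp add: algebra_simps)
  also have "\<dots> = (r + 1) * (p t * q (Suc t)) + (r * (q (Suc t) * p (Suc (Suc t)) - 1) - 1)"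
    by (simp only: qp)
  also have "\<dots> = (q (Suc t) * r) * (p t + p (Suc (Suc t)))"
    using qp(3) by (simp add: algebra_simps)
  finally show ?thesis using r(2) q_nz[of "Suc t"] by simp
qed

text \<open>
  As functions of their starting point, \<open>p\<close> and the arcs ending at a fixed vertex solve the same
  recurrence of order two, so their Wronskian is constant.
\<close>

lemma wronskian: "Suc l \<le> n \<Longrightarrow> p (Suc t) * d t (Suc l) - p t * d (Suc t) l = p (t + Suc l)"
proof (induction l arbitrary: t)
  case 0
  then show ?case by (simp add: d_0 d_1)
next
  case (Suc l)
  have rec: "d t (Suc (Suc l)) = d t (Suc (Suc 0)) * d (Suc t) (Suc l) - d (Suc (Suc t)) l"
    using d_recurrence[of l t] Suc.prems by simp
  have "p (Suc t) * d t (Suc (Suc l)) - p t * d (Suc t) (Suc l)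
      = (d t (Suc (Suc 0)) * p (Suc t) - p t) * d (Suc t) (Suc l) - p (Suc t) * d (Suc (Suc t)) l"
    by (simp add: rec algebra_simps)
  also have "\<dots> = p (Suc (Suc t)) * d (Suc t) (Suc l) - p (Suc t) * d (Suc (Suc t)) l"
    using p_recurrence[of t] by (simp only: add_diff_cancel_left')
  also have "\<dots> = p (t + Suc (Suc l))" using Suc.IH[of "Suc t"] Suc.prems by simp
  finally show ?case .
qed

lemma p_periodic: "p (t + n) = p t"
proof -
  obtain m where m: "n = Suc m" using n that[of "n - 1"] by simp
  have "p (t + n) = p (Suc t) * (p t * q t) - p t * (p t * q (Suc t) - 1)"
    using wronskian[of m t] m d_n[of t] cross(1)[of t] by simp
  also have "\<dots> = p t" using cross[of t] by (simp add: algebra_simps)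
  finally show ?thesis .
qed

text \<open>
  The position of vertex \<open>t\<close> on the real line when the puncture is sent to infinity: after division
  by the values of \<open>p\<close> at its ends, an arc becomes the difference of two positions.
\<close>

definition x :: "nat \<Rightarrow> real" where
  "x t = (\<Sum>l<t. 1 / (real_of_int (p l) * real_of_int (p (Suc l))))"

lemma x_Suc: "x (Suc t) - x t = 1 / (real_of_int (p t) * real_of_int (p (Suc t)))"
  by (simp add: x_def)

lemma d_eq_chord: "l \<le> n \<Longrightarrow> real_of_int (d t l) = real_of_int (p t) * real_of_int (p (t + l)) * (x (t + l) - x t)"
proof (induction l arbitrary: t)
  case 0
  then show ?case by (simp add: d_0)
next
  case (Suc l)
  have nz: "real_of_int (p t) \<noteq> 0" "real_of_int (p (Suc t)) \<noteq> 0" by (simp_all add: p_nz)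
  have IH: "real_of_int (d (Suc t) l) =
      real_of_int (p (Suc t)) * real_of_int (p (t + Suc l)) * (x (t + Suc l) - x (Suc t))"
    using Suc.IH[of "Suc t"] Suc.prems by simp
  have "real_of_int (p (Suc t)) * real_of_int (d t (Suc l)) =
      real_of_int (p (t + Suc l)) + real_of_int (p t) * real_of_int (d (Suc t) l)"
    using arg_cong[OF wronskian[of l t], of real_of_int] Suc.prems by simp
  also have "\<dots> = real_of_int (p (t + Suc l)) * (real_of_int (p t) * real_of_int (p (Suc t))) *
      ((x (Suc t) - x t) + (x (t + Suc l) - x (Suc t)))"
    unfolding IH x_Suc using nz by (simp add: field_simps)
  also have "\<dots> = real_of_int (p (Suc t)) *
      (real_of_int (p t) * real_of_int (p (t + Suc l)) * (x (t + Suc l) - x t))"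
    by (simp add: algebra_simps)
  finally show ?case unfolding mult_left_cancel[OF nz(2)] .
qed

definition \<rho> :: real where "\<rho> = real_of_int (q 0) / real_of_int (p 0)"

lemma q_eq: "real_of_int (q t) = \<rho> * real_of_int (p t)"
proof (induction t)
  case 0
  then show ?case by (simp add: \<rho>_def p_nz)
next
  case (Suc t)
  have "real_of_int (p t) * real_of_int (q (Suc t)) = real_of_int (q t) * real_of_int (p (Suc t))"
    using cross[of t] by (metis of_int_mult)
  then have "real_of_int (p t) * real_of_int (q (Suc t)) = real_of_int (p t) * (\<rho> * real_of_int (p (Suc t)))"
    by (simp add: Suc)
  then show ?case by (simp add: p_nz)
qed

lemma x_shift: "x (t + n) - x t = \<rho>"
proof -
  have "real_of_int (p t) * real_of_int (p t) * (x (t + n) - x t) = real_of_int (p t) * real_of_int (p t) * \<rho>"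
    using d_eq_chord[of n t] unfolding p_periodic d_n of_int_mult q_eq by (auto simp: mult_ac)
  then show ?thesis by (simp add: p_nz)
qed

lemma chord_ge_1:
  assumes "0 < l" "l \<le> n"
  shows "1 \<le> \<bar>real_of_int (p t) * real_of_int (p (t + l)) * (x (t + l) - x t)\<bar>"
proof -
  have "d t l \<noteq> 0"
    using assms d_nz[of l t] d_n[of t] p_nz[of t] q_nz[of t] by (cases "l = n") auto
  then have "1 \<le> \<bar>real_of_int (d t l)\<bar>" by linarith
  then show ?thesis using d_eq_chord[of l t] assms by simp
qed

text \<open>
  The translation \<open>\<rho>\<close> is no shorter than any step of \<open>x\<close>, because \<open>q t * p (Suc t)\<close> is a non-zero
  integer.
\<close>

lemma step_le_translation: "\<bar>1 / (real_of_int (p t) * real_of_int (p (Suc t)))\<bar> \<le> \<bar>\<rho>\<bar>"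
proof (rule ccontr)
  assume "\<not> ?thesis"
  then have *: "\<bar>\<rho>\<bar> < \<bar>1 / (real_of_int (p t) * real_of_int (p (Suc t)))\<bar>" by (simp only: not_le)
  have "0 < \<bar>real_of_int (p t) * real_of_int (p (Suc t))\<bar>" by (simp add: p_nz)
  then have "\<bar>\<rho>\<bar> * \<bar>real_of_int (p t) * real_of_int (p (Suc t))\<bar> < 1"
    using * by (simp add: pos_less_divide_eq)
  then have "\<bar>real_of_int (q t * p (Suc t))\<bar> < 1"
    by (simp add: q_eq abs_mult mult_ac)
  then have "q t * p (Suc t) = 0" by linarith
  then show False by (simp add: p_nz q_nz)
qed

text \<open>
  If the path turned at \<open>Suc t\<close>, then of the two edges meeting there one would lie under the other,
  and the path, followed from the shorter edge, would stay trapped for \<open>n\<close> steps, contrary to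
  \<open>step_le_translation\<close>.  It may have to be followed backwards, which is possible since \<open>n \<le> t\<close>.
\<close>

lemma x_monotone:
  assumes t: "n \<le> t"
  shows "0 < (x (Suc t) - x t) * (x (Suc (Suc t)) - x (Suc t))"
proof (rule ccontr)
  assume "\<not> ?thesis"
  moreover have "x (Suc t) \<noteq> x t" "x (Suc (Suc t)) \<noteq> x (Suc t)"
    using x_Suc[of t] x_Suc[of "Suc t"] p_nz by auto
  ultimately have turn: "(x t < x (Suc t) \<and> x (Suc (Suc t)) < x (Suc t)) \<or>
      (x (Suc t) < x t \<and> x (Suc t) < x (Suc (Suc t)))"
    by (auto simp: zero_less_mult_iff)
  have "x (Suc (Suc t)) \<noteq> x t" using chord_ge_1[of "Suc (Suc 0)" t] n by auto
  then consider
      (fwd) "(x t < x (Suc (Suc t)) \<and> x (Suc (Suc t)) < x (Suc t)) \<or>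
        (x (Suc t) < x (Suc (Suc t)) \<and> x (Suc (Suc t)) < x t)"
    | (bwd) "(x (Suc (Suc t)) < x t \<and> x t < x (Suc t)) \<or> (x (Suc t) < x t \<and> x t < x (Suc (Suc t)))"
    using turn by linarith
  then show False
  proof cases
    case fwd
    define u where "u i = real_of_int (p (t + i))" for i
    define y where "y i = x (t + i)" for i
    have "(y 0 < y n \<and> y n < y 1) \<or> (y 1 < y n \<and> y n < y 0)"
    proof (rule Farey_path_trapped[of n u])
      show "\<bar>u i * u (Suc i) * (y (Suc i) - y i)\<bar> = 1" for i
        using p_nz by (simp add: u_def y_def x_Suc)
      show "1 \<le> \<bar>u i * u j * (y j - y i)\<bar>" if "i < j" "j \<le> n" for i j
        using chord_ge_1[of "j - i" "t + i"] that by (simp add: u_def y_def)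
    qed (use fwd n in \<open>auto simp: y_def numeral_2_eq_2\<close>)
    then have "\<bar>y n - y 0\<bar> < \<bar>y 1 - y 0\<bar>" by linarith
    then have "\<bar>\<rho>\<bar> < \<bar>1 / (real_of_int (p t) * real_of_int (p (Suc t)))\<bar>"
      using x_shift[of t] x_Suc[of t] by (simp add: y_def)
    then show False using step_le_translation[of t] by linarith
  next
    case bwd
    define u where "u i = real_of_int (p (t + 2 - i))" for i
    define y where "y i = x (t + 2 - i)" for i
    have "(y 0 < y n \<and> y n < y 1) \<or> (y 1 < y n \<and> y n < y 0)"
    proof (rule Farey_path_trapped[of n u])
      show "\<bar>u i * u (Suc i) * (y (Suc i) - y i)\<bar> = 1" if "i < n" for i
      proof -
        define r where "r = t + 2 - Suc i"
        have r: "t + 2 - i = Suc r" using that t by (simp add: r_def)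
        have "u i * u (Suc i) * (y (Suc i) - y i) = - (real_of_int (p r) * real_of_int (p (Suc r)) * (x (Suc r) - x r))"
          unfolding u_def y_def r r_def[symmetric] by (simp only: algebra_simps)
        then show ?thesis by (simp add: x_Suc p_nz)
      qed
      show "1 \<le> \<bar>u i * u j * (y j - y i)\<bar>" if "i < j" "j \<le> n" for i j
      proof -
        define r where "r = t + 2 - j"
        have r: "t + 2 - i = r + (j - i)" using that t by (simp add: r_def)
        have "u i * u j * (y j - y i) = - (real_of_int (p r) * real_of_int (p (r + (j - i))) * (x (r + (j - i)) - x r))"
          unfolding u_def y_def r r_def[symmetric] by (simp only: algebra_simps)
        then show ?thesis using chord_ge_1[of "j - i" r] that by simp
      qed
    qed (use bwd n in \<open>auto simp: y_def numeral_2_eq_2\<close>)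
    then have "\<bar>y n - y 0\<bar> < \<bar>y 1 - y 0\<bar>" by linarith
    moreover have "y 0 - y n = \<rho>" using x_shift[of "t + 2 - n"] t by (simp add: y_def)
    moreover have "y 0 - y 1 = 1 / (real_of_int (p (Suc t)) * real_of_int (p (Suc (Suc t))))"
      using x_Suc[of "Suc t"] by (simp add: y_def)
    ultimately have "\<bar>\<rho>\<bar> < \<bar>1 / (real_of_int (p (Suc t)) * real_of_int (p (Suc (Suc t))))\<bar>"
      by linarith
    then show False using step_le_translation[of "Suc t"] by linarith
  qed
qed

lemma p_turn_free: "n \<le> t \<Longrightarrow> sgn (p (Suc t)) * sgn (p (Suc (Suc t))) = sgn (p t) * sgn (p (Suc t))"
proof -
  assume "n \<le> t"
  then have "0 < 1 / real_of_int ((p t * p (Suc t)) * (p (Suc t) * p (Suc (Suc t))))"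
    using x_monotone[of t] by (simp add: x_Suc)
  then have "0 < (p t * p (Suc t)) * (p (Suc t) * p (Suc (Suc t)))"
    by (simp only: zero_less_divide_1_iff of_int_0_less_iff)
  then show ?thesis by (auto simp: zero_less_mult_iff mult_less_0_iff)
qed

text \<open>
  Here \<open>\<epsilon>\<close> is the direction of the path \<open>x\<close>.  When \<open>\<epsilon> = -1\<close> the signs of \<open>p\<close> alternate, and
  periodicity of \<open>p\<close> makes \<open>n\<close> even.
\<close>

lemma sign_pattern:
  obtains \<epsilon> \<sigma> :: int where "\<epsilon> \<in> {1, -1}" "\<sigma> \<in> {1, -1}" "\<epsilon> = 1 \<or> even n"
    "\<And>t. n \<le> t \<Longrightarrow> sgn (p t) = \<sigma> * \<epsilon> ^ t" "\<And>t. n \<le> t \<Longrightarrow> sgn (q t) = \<sigma> * \<epsilon> ^ Suc t"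
    "\<And>t l. n \<le> t \<Longrightarrow> 0 < l \<Longrightarrow> l \<le> n \<Longrightarrow> sgn (d t l) = \<epsilon> ^ Suc l"
proof -
  have S: "sgn (p t) = 1 \<or> sgn (p t) = - 1" for t using p_nz[of t] by (auto simp: sgn_if)
  define \<epsilon> where "\<epsilon> = sgn (p n) * sgn (p (Suc n))"
  define \<sigma> where "\<sigma> = sgn (p n) * \<epsilon> ^ n"
  have \<epsilon>: "\<epsilon> \<in> {1, -1}" unfolding \<epsilon>_def using S[of n] S[of "Suc n"] by auto
  have \<epsilon>2: "\<epsilon> * \<epsilon> = 1" using \<epsilon> by auto
  have \<epsilon>p: "\<epsilon> ^ k * \<epsilon> ^ k = 1" for k using \<epsilon>2 by (metis power_mult_distrib power_one)
  have \<epsilon>pm: "\<epsilon> ^ k \<in> {1, -1}" for k using \<epsilon> by (induction k) auto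
  have \<sigma>: "\<sigma> \<in> {1, -1}" unfolding \<sigma>_def using S[of n] \<epsilon>pm[of n] by auto
  have \<epsilon>_eq: "sgn (p t) * sgn (p (Suc t)) = \<epsilon>" if "n \<le> t" for t
    using that by (induction t rule: dec_induct) (simp_all add: \<epsilon>_def p_turn_free)
  have sgn_p: "sgn (p t) = \<sigma> * \<epsilon> ^ t" if "n \<le> t" for t
    using that
  proof (induction t rule: dec_induct)
    case base
    then show ?case using \<epsilon>p[of n] by (simp add: \<sigma>_def mult.assoc)
  next
    case (step t)
    have "sgn (p (Suc t)) = sgn (p t) * \<epsilon>" using \<epsilon>_eq[of t] step S[of t] by auto
    then show ?case using step by simp
  qed
  have even: "\<epsilon> = 1 \<or> even n"
  proof -
    have "\<sigma> * \<epsilon> ^ (n + n) = \<sigma> * \<epsilon> ^ n" by (metis le_add1 order_refl p_periodic sgn_p)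
    then have "\<epsilon> ^ n = 1" using \<sigma> \<epsilon>p[of n] by (auto simp: power_add)
    then show ?thesis using \<epsilon> by (cases "even n") auto
  qed
  have step_pos: "0 < real_of_int \<epsilon> * (x (Suc t) - x t)" if "n \<le> t" for t
  proof -
    define z where "z = p t * p (Suc t)"
    have "\<epsilon> = sgn z" using \<epsilon>_eq[OF that] by (simp add: sgn_mult z_def)
    moreover have "z \<noteq> 0" by (simp add: z_def p_nz)
    ultimately have "0 < \<epsilon> * (p t * p (Suc t))" unfolding z_def[symmetric] by (auto simp: sgn_if)
    then have "0 < real_of_int (\<epsilon> * (p t * p (Suc t)))" by (simp only: of_int_0_less_iff)
    then show ?thesis by (simp add: x_Suc zero_less_divide_iff zero_less_mult_iff)
  qed
  have chord_pos: "0 < real_of_int \<epsilon> * (x (t + Suc l) - x t)" if "n \<le> t" for t l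
  proof (induction l)
    case 0
    then show ?case using step_pos[OF that] by simp
  next
    case (Suc l)
    then show ?case using step_pos[of "t + Suc l"] that by (simp add: algebra_simps)
  qed
  have sgn_d: "sgn (d t l) = \<epsilon> ^ Suc l" if "n \<le> t" "0 < l" "l \<le> n" for t l
  proof -
    obtain m where m: "l = Suc m" using \<open>0 < l\<close> gr0_implies_Suc by blast
    have "0 < real_of_int \<epsilon> * (x (t + l) - x t)" using chord_pos[of t m] that m by simp
    then have "sgn (x (t + l) - x t) = real_of_int \<epsilon>"
      using \<epsilon> by (auto simp: sgn_if)
    moreover have "real_of_int (sgn z) = sgn (real_of_int z)" for z by (simp add: sgn_if)
    ultimately have "real_of_int (sgn (d t l)) = real_of_int (sgn (p t) * sgn (p (t + l)) * \<epsilon>)"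
      using arg_cong[OF d_eq_chord[of l t], of sgn] that by (simp add: sgn_mult)
    then have "sgn (d t l) = sgn (p t) * sgn (p (t + l)) * \<epsilon>" by (simp only: of_int_eq_iff)
    also have "\<dots> = (\<sigma> * \<sigma>) * (\<epsilon> ^ t * \<epsilon> ^ t) * \<epsilon> ^ Suc l"
      using sgn_p[of t] sgn_p[of "t + l"] that by (simp add: power_add)
    finally show ?thesis using \<sigma> \<epsilon>p by auto
  qed
  have sgn_q: "sgn (q t) = \<sigma> * \<epsilon> ^ Suc t" if "n \<le> t" for t
  proof -
    have "sgn (p t) * sgn (q t) = \<epsilon> ^ Suc n"
      using sgn_d[of t n] that n by (simp add: d_n sgn_mult)
    then have "sgn (q t) = sgn (p t) * \<epsilon> * \<epsilon> ^ n" using S[of t] by auto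
    moreover have "\<epsilon> ^ n = 1" using even \<epsilon> by auto
    ultimately show ?thesis using sgn_p[OF that] by simp
  qed
  show ?thesis using that[OF \<epsilon> \<sigma> even sgn_p sgn_q sgn_d] .
qed

text \<open>
  Both facts compare \<open>x\<close> over part of a period with its increment \<open>\<rho>\<close> over the whole period; the
  sum telescopes because \<open>q\<close> is \<open>\<rho>\<close> times \<open>p\<close>.
\<close>

lemma positive_bounds:
  assumes pos: "\<And>t. 0 < p t" "\<And>t. 0 < q t"
  shows "(\<Sum>i<n. 1 / real_of_int (p (t + i) * q (Suc (t + i)))) = 1"
    and "l \<le> n \<Longrightarrow> d t l \<le> q t * p (t + l)"
proof -
  have \<rho>: "0 < \<rho>" using pos[of 0] by (simp add: \<rho>_def)
  have tel: "(\<Sum>i<m. x (Suc (t + i)) - x (t + i)) = x (t + m) - x t" for m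
    by (induction m) auto
  have "(\<Sum>i<n. 1 / real_of_int (p (t + i) * q (Suc (t + i)))) = (\<Sum>i<n. (x (Suc (t + i)) - x (t + i)) / \<rho>)"
    by (intro sum.cong refl) (simp add: q_eq x_Suc mult_ac)
  also have "\<dots> = (\<Sum>i<n. x (Suc (t + i)) - x (t + i)) / \<rho>" by (rule sum_divide_distrib[symmetric])
  also have "\<dots> = 1" using \<rho> unfolding tel x_shift by simp
  finally show "(\<Sum>i<n. 1 / real_of_int (p (t + i) * q (Suc (t + i)))) = 1" .
  assume l: "l \<le> n"
  have "incseq x" by (intro incseq_SucI) (simp add: x_def less_imp_le[OF pos(1)])
  then have "x (t + l) \<le> x (t + n)" using l by (simp add: incseqD)
  then have "x (t + l) - x t \<le> \<rho>" using x_shift[of t] by linarith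
  then have "real_of_int (p t) * real_of_int (p (t + l)) * (x (t + l) - x t)
      \<le> real_of_int (p t) * real_of_int (p (t + l)) * \<rho>"
    using pos[of t] pos[of "t + l"] by (intro mult_left_mono) auto
  also have "\<dots> = real_of_int (q t * p (t + l))" by (simp add: q_eq)
  finally have "real_of_int (d t l) \<le> real_of_int (q t * p (t + l))"
    unfolding d_eq_chord[OF l, of t] .
  then show "d t l \<le> q t * p (t + l)" by (simp only: of_int_le_iff)
qed

end

text \<open>
  A value of \<open>q\<close> is bounded through its product with the preceding value of \<open>p\<close>, hence \<open>0 < t\<close>.
\<close>

lemma positive_D_friezes_bounded:
  "\<exists>B. \<forall>d p q. D_frieze n d p q \<longrightarrow> (\<forall>t. 0 < p t \<and> 0 < q t) \<longrightarrow>
     (\<forall>t>0. p t \<le> B \<and> q t \<le> B \<and> (\<forall>l\<le>n. d t l \<le> B))"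
proof -
  obtain C where C: "\<forall>s :: nat \<Rightarrow> int. (\<forall>i\<in>{..<n}. 0 < s i) \<longrightarrow>
      (\<Sum>i<n. 1 / real_of_int (s i)) = 1 \<longrightarrow> (\<forall>i\<in>{..<n}. s i \<le> C)"
    using unit_fraction_sum_bound[of "{..<n}" 1] finite_lessThan[of n] by blast
  have bound: "p t \<le> C + C * C \<and> q t \<le> C + C * C \<and> (\<forall>l\<le>n. d t l \<le> C + C * C)"
    if D: "D_frieze n d p q" and pos: "\<forall>t. 0 < p t \<and> 0 < q t" and t: "0 < t" for d p q t
  proof -
    interpret D_frieze n d p q by (rule D)
    have pq: "p t * q (Suc t) \<le> C" for t
    proof -
      have sum: "(\<Sum>i<n. 1 / real_of_int (p (t + i) * q (Suc (t + i)))) = 1"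
        by (rule positive_bounds(1)) (simp_all add: pos)
      have "\<forall>i\<in>{..<n}. p (t + i) * q (Suc (t + i)) \<le> C"
        by (rule C[THEN spec, THEN mp, THEN mp, OF _ sum]) (simp add: pos)
      then have "p (t + 0) * q (Suc (t + 0)) \<le> C" by (rule bspec) (use n in simp)
      then show ?thesis by (simp only: add_0_right)
    qed
    have p: "p t \<le> C" for t
    proof -
      have "p t * 1 \<le> p t * q (Suc t)"
        using mult_left_mono[of 1 "q (Suc t)" "p t"] pos[rule_format, of t] pos[rule_format, of "Suc t"] by simp
      then show ?thesis using order_trans[OF _ pq] by (simp only: mult_1 mult_1_right)
    qed
    have q: "q (Suc t) \<le> C" for t
    proof -
      have "1 * q (Suc t) \<le> p t * q (Suc t)"
        using mult_right_mono[of 1 "p t" "q (Suc t)"] pos[rule_format, of t] pos[rule_format, of "Suc t"] by simp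
      then show ?thesis using order_trans[OF _ pq] by (simp only: mult_1 mult_1_right)
    qed
    have qt: "q t \<le> C" using q[of "t - 1"] t by simp
    have "0 \<le> C" using p[of t] pos[rule_format, of t] by linarith
    then have "0 \<le> C * C" by simp
    have "d t l \<le> C * C" if "l \<le> n" for l
    proof -
      have "d t l \<le> q t * p (t + l)" using positive_bounds(2)[OF _ _ that] pos by simp
      moreover have "q t * p (t + l) \<le> C * C"
        using qt p[of "t + l"] \<open>0 \<le> C\<close> pos[rule_format, of "t + l"] by (intro mult_mono) auto
      ultimately show ?thesis by (rule order_trans)
    qed
    then have "d t l \<le> C + C * C" if "l \<le> n" for l
      using that \<open>0 \<le> C\<close> by (simp add: add_increasing)
    moreover have "p t \<le> C + C * C" "q t \<le> C + C * C" using p[of t] qt \<open>0 \<le> C * C\<close> by linarith+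
    ultimately show ?thesis by blast
  qed
  show ?thesis by (intro exI[of _ "C + C * C"] allI impI) (rule bound)
qed

section \<open>The exchange relations on the diagram\<close>

definition D_nbrs :: "nat \<Rightarrow> nat \<Rightarrow> nat set" where
  "D_nbrs k i = {j. {i, j} \<in> dynkin_D k}"

lemma dynkin_D_edge_iff:
  "{i, j} \<in> dynkin_D (m + 4) \<longleftrightarrow>
     (j = Suc i \<and> i \<le> m + 1) \<or> (i = Suc j \<and> j \<le> m + 1) \<or>
     (i = m + 1 \<and> j = m + 3) \<or> (i = m + 3 \<and> j = m + 1)"
  by (auto simp: dynkin_D_def doubleton_eq_iff)

lemma D_nbrs_simps:
  "D_nbrs (m + 4) 0 = {1}"
  "0 < i \<Longrightarrow> i \<le> m \<Longrightarrow> D_nbrs (m + 4) i = {i - 1, Suc i}"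
  "D_nbrs (m + 4) (m + 1) = {m, m + 2, m + 3}"
  "D_nbrs (m + 4) (m + 2) = {m + 1}"
  "D_nbrs (m + 4) (m + 3) = {m + 1}"
  unfolding D_nbrs_def dynkin_D_edge_iff by auto

lemma D_vertex_cases:
  assumes "i < m + (4 :: nat)"
  obtains "i = 0" | "0 < i" "i \<le> m" | "i = m + 1" | "i = m + 2" | "i = m + 3"
  using assms by linarith

lemma D_nbrs_less: "j \<in> D_nbrs (m + 4) i \<Longrightarrow> i < m + 4 \<and> j < m + 4"
  by (auto simp: D_nbrs_def dynkin_D_edge_iff)

text \<open>
  The number of edges on the path from \<open>0\<close> to \<open>i\<close> that point towards \<open>0\<close>.  Delaying vertex \<open>i\<close> by
  this amount turns the exchange relations of an arbitrary orientation into those of the orientation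
  in which all edges point away from \<open>0\<close>.
\<close>

definition lag :: "nat \<Rightarrow> (nat \<times> nat) set \<Rightarrow> nat \<Rightarrow> nat" where
  "lag m Q i =
     (if i = m + 3 then (\<Sum>j<m + 1. of_bool ((Suc j, j) \<in> Q)) + of_bool ((m + 3, m + 1) \<in> Q)
      else (\<Sum>j<i. of_bool ((Suc j, j) \<in> Q)))"

lemma lag_diff:
  assumes Q: "orientation_of (dynkin_D (m + 4)) Q" and j: "j \<in> D_nbrs (m + 4) i"
  shows "lag m Q i + of_bool ((j, i) \<in> Q) = lag m Q j + of_bool (j < i)"
proof -
  have flip: "(i, j) \<in> Q \<longleftrightarrow> (j, i) \<notin> Q"
    using Q j unfolding orientation_of_def D_nbrs_def by blast
  have "j = Suc i \<and> i \<le> m + 1 \<or> i = Suc j \<and> j \<le> m + 1 \<or> i = m + 1 \<and> j = m + 3 \<or> i = m + 3 \<and> j = m + 1"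
    using j by (simp add: D_nbrs_def dynkin_D_edge_iff)
  then show ?thesis using flip by (elim disjE conjE) (auto simp: lag_def)
qed

text \<open>
  \<open>Y t i\<close> is the value at vertex \<open>i\<close> after \<open>t\<close> rounds in which every vertex is mutated once, sources
  first: when \<open>i\<close> is mutated, exactly its neighbours \<open>j\<close> with an arrow to \<open>i\<close> are already in the
  next round.
\<close>

locale D_mesh =
  fixes m :: nat and Q :: "(nat \<times> nat) set" and Y :: "nat \<Rightarrow> nat \<Rightarrow> int"
  assumes orient: "orientation_of (dynkin_D (m + 4)) Q"
    and exchange: "i < m + 4 \<Longrightarrow>
      Y t i * Y (Suc t) i = 1 + (\<Prod>j\<in>D_nbrs (m + 4) i. Y (t + of_bool ((j, i) \<in> Q)) j)"
    and Y_nz: "i < m + 4 \<Longrightarrow> Y t i \<noteq> 0"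
begin

definition F :: "nat \<Rightarrow> nat \<Rightarrow> int" where "F t i = Y (t + lag m Q i) i"

lemma F_exchange:
  assumes "i < m + 4"
  shows "F t i * F (Suc t) i = 1 + (\<Prod>j\<in>D_nbrs (m + 4) i. F (t + of_bool (j < i)) j)"
proof -
  have "Y (t + lag m Q i + of_bool ((j, i) \<in> Q)) j = F (t + of_bool (j < i)) j"
    if "j \<in> D_nbrs (m + 4) i" for j
    using lag_diff[OF orient that] by (simp add: F_def add.assoc add.commute[of "of_bool (j < i)"])
  then show ?thesis
    using exchange[OF assms, of "t + lag m Q i"] by (simp add: F_def)
qed

text \<open>
  The vertex \<open>i \<le> m + 1\<close> carries the arcs of length \<open>i + 2\<close>.  Each of the two vertices at the fork
  carries plain and notched arcs alternately, since rotating the polygon by one step exchanges the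
  taggings; hence \<open>p\<close> and \<open>q\<close> switch between \<open>m + 2\<close> and \<open>m + 3\<close> with the parity of \<open>t\<close>.
\<close>

definition d :: "nat \<Rightarrow> nat \<Rightarrow> int" where
  "d t l = (if l = 0 then 0 else if l = 1 then 1 else if l = m + 4 then F t (m + 2) * F t (m + 3)
            else F t (l - 2))"

definition p :: "nat \<Rightarrow> int" where "p t = (if even t then F t (m + 2) else F t (m + 3))"
definition q :: "nat \<Rightarrow> int" where "q t = (if even t then F t (m + 3) else F t (m + 2))"

lemma F_mesh:
  "F t 0 * F (Suc t) 0 = 1 + F t 1"
  "0 < i \<Longrightarrow> i \<le> m \<Longrightarrow> F t i * F (Suc t) i = 1 + F (Suc t) (i - 1) * F t (Suc i)"
  "F t (m + 1) * F (Suc t) (m + 1) = 1 + F (Suc t) m * (F t (m + 2) * F t (m + 3))"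
  "F t (m + 2) * F (Suc t) (m + 2) = 1 + F (Suc t) (m + 1)"
  "F t (m + 3) * F (Suc t) (m + 3) = 1 + F (Suc t) (m + 1)"
proof -
  show "F t 0 * F (Suc t) 0 = 1 + F t 1"
    using F_exchange[of 0 t] by (simp add: D_nbrs_simps)
  show "F t i * F (Suc t) i = 1 + F (Suc t) (i - 1) * F t (Suc i)" if "0 < i" "i \<le> m"
    using F_exchange[of i t] that by (simp add: D_nbrs_simps)
  show "F t (m + 1) * F (Suc t) (m + 1) = 1 + F (Suc t) m * (F t (m + 2) * F t (m + 3))"
    using F_exchange[of "m + 1" t] unfolding D_nbrs_simps(3) by simp
  show "F t (m + 2) * F (Suc t) (m + 2) = 1 + F (Suc t) (m + 1)"
    using F_exchange[of "m + 2" t] unfolding D_nbrs_simps(4) by simp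
  show "F t (m + 3) * F (Suc t) (m + 3) = 1 + F (Suc t) (m + 1)"
    using F_exchange[of "m + 3" t] unfolding D_nbrs_simps(5) by simp
qed

lemma F_nz: "i < m + 4 \<Longrightarrow> F t i \<noteq> 0"
  by (simp add: F_def Y_nz)

lemma D_frieze: "D_frieze (m + 4) d p q"
proof
  fix t l
  show "d t l * d (Suc t) l = 1 + d (Suc t) (l - 1) * d t (Suc l)" if l: "0 < l" "l < m + 4"
  proof -
    consider "l = 1" | "l = 2" | i where "l = i + 2" "0 < i" "i \<le> m" | "l = m + 3"
    proof -
      assume a: "l = 1 \<Longrightarrow> thesis" "l = 2 \<Longrightarrow> thesis"
        "\<And>i. l = i + 2 \<Longrightarrow> 0 < i \<Longrightarrow> i \<le> m \<Longrightarrow> thesis" "l = m + 3 \<Longrightarrow> thesis"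
      show thesis using l a(1,2,4) a(3)[of "l - 2"] by linarith
    qed
    then show ?thesis
    proof cases
      case 1
      then show ?thesis by (simp add: d_def)
    next
      case 2
      then show ?thesis using F_mesh(1)[of t] by (simp add: d_def)
    next
      case (3 i)
      then show ?thesis using F_mesh(2)[of i t] by (simp add: d_def)
    next
      case 4
      then show ?thesis using F_mesh(3)[of t] by (simp add: d_def)
    qed
  qed
  show "d t l \<noteq> 0" if "0 < l" "l < m + 4"
    using that F_nz[of "l - 2" t] by (auto simp: d_def)
qed (use F_nz F_mesh(4,5) in \<open>auto simp: d_def p_def q_def\<close>)

text \<open>
  The alternation built into \<open>p\<close> and \<open>q\<close> makes the sign at each vertex independent of \<open>t\<close>.  The
  vertex \<open>m + 1\<close> is where evenness of \<open>m + 4\<close> in the alternating case is used.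
\<close>

lemma F_sign:
  obtains s where "\<And>i t. i < m + 4 \<Longrightarrow> m + 4 \<le> t \<Longrightarrow> sgn (F t i) = s i"
    "\<And>i. i < m + 4 \<Longrightarrow> (\<Prod>j\<in>D_nbrs (m + 4) i. s j) = 1"
proof -
  interpret D_frieze "m + 4" d p q by (rule D_frieze)
  obtain \<epsilon> \<sigma> where \<epsilon>: "\<epsilon> \<in> {1, -1}" and \<sigma>: "\<sigma> \<in> {1, -1}" and even: "\<epsilon> = 1 \<or> even (m + 4)"
    and P: "\<And>t. m + 4 \<le> t \<Longrightarrow> sgn (p t) = \<sigma> * \<epsilon> ^ t"
    and Qs: "\<And>t. m + 4 \<le> t \<Longrightarrow> sgn (q t) = \<sigma> * \<epsilon> ^ Suc t"
    and D: "\<And>t l. m + 4 \<le> t \<Longrightarrow> 0 < l \<Longrightarrow> l \<le> m + 4 \<Longrightarrow> sgn (d t l) = \<epsilon> ^ Suc l"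
    using sign_pattern by blast
  define s where "s i = (if i < m + 2 then \<epsilon> ^ Suc i else if i = m + 2 then \<sigma> else \<sigma> * \<epsilon>)" for i
  have \<epsilon>\<epsilon>: "\<epsilon> * \<epsilon> = 1" "\<sigma> * \<sigma> = 1" "\<And>a. \<epsilon> * (\<epsilon> * a) = a" "\<And>a. \<sigma> * (\<sigma> * a) = a" using \<epsilon> \<sigma> by auto
  have \<epsilon>p: "\<epsilon> ^ i * \<epsilon> ^ i = 1" for i using \<epsilon>\<epsilon> by (metis power_mult_distrib power_one)
  have \<epsilon>m: "\<epsilon> * \<epsilon> ^ Suc m = 1" using even \<epsilon> by auto
  have "sgn (F t i) = s i" if i: "i < m + 4" and t: "m + 4 \<le> t" for i t
  proof -
    consider "i < m + 2" | "i = m + 2" | "i = m + 3" using i by linarith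
    then show ?thesis
    proof cases
      case 1
      then show ?thesis using D[of t "i + 2"] t \<epsilon>\<epsilon> by (simp add: d_def s_def)
    next
      case 2
      then show ?thesis using P[OF t] Qs[OF t] \<epsilon> by (auto simp: p_def q_def s_def split: if_splits)
    next
      case 3
      then show ?thesis using P[OF t] Qs[OF t] \<epsilon> by (auto simp: p_def q_def s_def split: if_splits)
    qed
  qed
  moreover have "(\<Prod>j\<in>D_nbrs (m + 4) i. s j) = 1" if "i < m + 4" for i
    using that
  proof (cases rule: D_vertex_cases)
    case 1
    then show ?thesis using \<epsilon>\<epsilon> by (simp add: D_nbrs_simps s_def)
  next
    case 2
    then obtain j where "i = Suc j" by (cases i) auto
    then show ?thesis using 2 \<epsilon>\<epsilon> \<epsilon>p by (simp add: D_nbrs_simps s_def mult_ac)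
  next
    case 3
    have "(\<Prod>j\<in>D_nbrs (m + 4) i. s j) = \<epsilon> ^ Suc m * (\<sigma> * (\<sigma> * \<epsilon>))"
      unfolding 3 D_nbrs_simps(3) by (simp add: s_def)
    also have "\<dots> = (\<sigma> * \<sigma>) * (\<epsilon> * \<epsilon> ^ Suc m)" by (simp only: mult_ac)
    finally show ?thesis using \<epsilon>\<epsilon>(2) \<epsilon>m by (simp only: mult_1)
  next
    case 4
    then show ?thesis unfolding 4 D_nbrs_simps(4) using \<epsilon>m \<epsilon>\<epsilon> by (simp add: s_def)
  next
    case 5
    then show ?thesis unfolding 5 D_nbrs_simps(5) using \<epsilon>m \<epsilon>\<epsilon> by (simp add: s_def)
  qed
  ultimately show ?thesis using that by blast
qed

end

text \<open>
  A round so late that every vertex, after subtraction of its lag, has left the first \<open>m + 4\<close> steps,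
  about which \<open>sign_pattern\<close> says nothing.
\<close>

definition late :: "nat \<Rightarrow> (nat \<times> nat) set \<Rightarrow> nat" where
  "late m Q = m + 4 + (\<Sum>i<m + 4. lag m Q i)"

lemma late: "i < m + 4 \<Longrightarrow> \<exists>t. m + 4 \<le> t \<and> late m Q = t + lag m Q i"
  unfolding late_def using member_le_sum[of i "{..<m + 4}" "lag m Q"]
  by (intro exI[of _ "m + 4 + (\<Sum>i<m + 4. lag m Q i) - lag m Q i"]) auto

lemma D_mesh_signs_balanced:
  assumes "D_mesh m Q Y" and i: "i < m + 4"
  shows "(\<Prod>j\<in>D_nbrs (m + 4) i. sgn (Y (late m Q) j)) = 1"
proof -
  interpret D_mesh m Q Y by fact
  obtain s where s: "\<And>i t. i < m + 4 \<Longrightarrow> m + 4 \<le> t \<Longrightarrow> sgn (F t i) = s i"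
    "\<And>i. i < m + 4 \<Longrightarrow> (\<Prod>j\<in>D_nbrs (m + 4) i. s j) = 1"
    using F_sign by blast
  have "sgn (Y (late m Q) j) = s j" if "j \<in> D_nbrs (m + 4) i" for j
    using late[of j m Q] s(1)[of j] D_nbrs_less[OF that] by (auto simp: F_def)
  then show ?thesis using s(2)[OF i] by simp
qed

lemma D_mesh_positive_bounded:
  "\<exists>B. \<forall>Y. D_mesh m Q Y \<longrightarrow> (\<forall>t. \<forall>i<m + 4. 0 < Y t i) \<longrightarrow> (\<forall>i<m + 4. Y (late m Q) i \<le> B)"
proof -
  obtain B where B: "\<forall>d p q. D_frieze (m + 4) d p q \<longrightarrow> (\<forall>t. 0 < p t \<and> 0 < q t) \<longrightarrow>
     (\<forall>t>0. p t \<le> B \<and> q t \<le> B \<and> (\<forall>l\<le>m + 4. d t l \<le> B))"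
    using positive_D_friezes_bounded[of "m + 4"] ..
  have "Y (late m Q) i \<le> B" if "D_mesh m Q Y" and pos: "\<forall>t. \<forall>i<m + 4. 0 < Y t i" and i: "i < m + 4" for Y i
  proof -
    interpret D_mesh m Q Y by fact
    obtain t where t: "m + 4 \<le> t" "late m Q = t + lag m Q i" using late[OF i, of Q] by blast
    have *: "p t \<le> B \<and> q t \<le> B \<and> (\<forall>l\<le>m + 4. d t l \<le> B)"
      using B[rule_format, OF D_frieze _ , of t] pos t by (simp add: p_def q_def F_def)
    have "F t i \<le> B"
    proof (cases "i < m + 2")
      case True
      then show ?thesis using *[THEN conjunct2, THEN conjunct2, rule_format, of "i + 2"] by (simp add: d_def)
    next
      case False
      then have "i = m + 2 \<or> i = m + 3" using i by linarith
      then show ?thesis using * by (auto simp: p_def q_def split: if_splits)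
    qed
    then show ?thesis by (simp add: F_def t(2))
  qed
  then show ?thesis by blast
qed

section \<open>Kernels of exchange matrices modulo 2\<close>

definition skew :: "exchange_matrix \<Rightarrow> bool" where
  "skew b \<longleftrightarrow> (\<forall>i j. b i j = - b j i)"

lemma skew_diag: "skew b \<Longrightarrow> b i i = 0"
  unfolding skew_def by (metis equal_neg_zero)

lemma skew_exchange_matrix_of: "skew (exchange_matrix_of Q)"
  by (simp add: skew_def exchange_matrix_of_def)

lemma skew_mutate_matrix:
  assumes "skew b" shows "skew (mutate_matrix m b)"
proof -
  have b: "b i j = - b j i" for i j using assms unfolding skew_def by blast
  have "mutate_matrix m b i j = - mutate_matrix m b j i" for i j
  proof -
    have *: "max 0 (b j m) * max 0 (b m i) = max 0 (- b i m) * max 0 (- b m j)"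
      "max 0 (- b j m) * max 0 (- b m i) = max 0 (b i m) * max 0 (b m j)"
      unfolding b[of j m] b[of m i] by simp_all
    show ?thesis unfolding mutate_matrix_def * using b[of i j] by auto
  qed
  then show ?thesis unfolding skew_def by blast
qed

lemma seeds_skew: "(x, b) \<in> seeds k Q \<Longrightarrow> skew b"
  by (induction rule: seeds.induct) (auto simp: skew_exchange_matrix_of skew_mutate_matrix)

lemma mutate_matrix_involutive: "mutate_matrix m (mutate_matrix m b) = b"
  by (intro ext) (simp add: mutate_matrix_def)

definition in_kernel :: "nat \<Rightarrow> exchange_matrix \<Rightarrow> (nat \<Rightarrow> int) \<Rightarrow> bool" where
  "in_kernel k b s \<longleftrightarrow> (\<forall>m<k. even (\<Sum>i<k. s i * b i m))"

text \<open>
  Modulo 2, \<open>s' m\<close> is \<open>s m\<close> plus the exponent by which the sign vector \<open>s\<close> acts on either of the two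
  exchange monomials.
\<close>

lemma in_kernel_mutate:
  assumes skew: "skew b" and m: "m < k" and ker: "in_kernel k b s"
    and s': "\<And>i. i \<noteq> m \<Longrightarrow> s' i = s i"
    and s'm: "even (s' m + s m + (\<Sum>i<k. s i * max 0 (b i m)))"
  shows "in_kernel k (mutate_matrix m b) s'"
  unfolding in_kernel_def
proof (intro allI impI)
  fix j assume j: "j < k"
  have bm: "b m m = 0" using skew by (rule skew_diag)
  have rem: "(\<Sum>i<k. f i) = f m + (\<Sum>i\<in>{..<k} - {m}. f i)" for f :: "nat \<Rightarrow> int"
    using m by (simp add: sum.remove)
  show "even (\<Sum>i<k. s' i * mutate_matrix m b i j)"
  proof (cases "j = m")
    case True
    have "(\<Sum>i<k. s' i * mutate_matrix m b i j) = - (\<Sum>i<k. s i * b i m)"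
      unfolding rem using bm True by (simp add: s' mutate_matrix_def sum_negf)
    then show ?thesis using ker m by (simp add: in_kernel_def)
  next
    case False
    define I where "I = {..<k} - {m}"
    define A where "A = (\<Sum>i\<in>I. s i * max 0 (b i m))"
    define B where "B = (\<Sum>i\<in>I. s i * max 0 (- b i m))"
    define E where "E = (\<Sum>i\<in>I. s i * b i j)"
    define u where "u = max 0 (b m j)"
    define v where "v = max 0 (- b m j)"
    have uv: "b m j = u - v" by (simp add: u_def v_def)
    have "A - B = (\<Sum>i\<in>I. s i * b i m)"
      unfolding A_def B_def sum_subtractf[symmetric] right_diff_distrib[symmetric]
      by (intro sum.cong refl) (simp add: max_def)
    also have "\<dots> = (\<Sum>i<k. s i * b i m)" unfolding rem I_def by (simp add: bm)
    finally have AB: "even (A - B)" using ker m by (simp add: in_kernel_def)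
    have A: "even (s' m + s m + A)" using s'm unfolding rem I_def[symmetric] by (simp add: bm A_def)
    have "(\<Sum>i<k. s i * b i j) = s m * (u - v) + E"
      unfolding rem I_def[symmetric] by (simp add: E_def uv)
    moreover have "even (\<Sum>i<k. s i * b i j)" using ker j unfolding in_kernel_def by blast
    ultimately have E: "even (s m * (u - v) + E)" by simp
    have "(\<Sum>i\<in>I. s' i * mutate_matrix m b i j)
        = (\<Sum>i\<in>I. s i * b i j + s i * max 0 (b i m) * u - s i * max 0 (- b i m) * v)"
      using False by (intro sum.cong refl) (auto simp: I_def s' mutate_matrix_def u_def v_def algebra_simps)
    also have "\<dots> = E + A * u - B * v"
      by (simp add: E_def A_def B_def sum.distrib sum_subtractf sum_distrib_right)
    finally have "(\<Sum>i\<in>I. s' i * mutate_matrix m b i j) = E + A * u - B * v" .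
    moreover have "s' m * mutate_matrix m b m j = - s' m * (u - v)"
      unfolding uv[symmetric] by (simp add: mutate_matrix_def)
    ultimately have "(\<Sum>i<k. s' i * mutate_matrix m b i j) = - s' m * (u - v) + (E + A * u - B * v)"
      unfolding rem I_def[symmetric] by (simp only:)
    \<comment> \<open>Regrouped so that every summand is even by one of the hypotheses.\<close>
    also have "\<dots> = (s m * (u - v) + E) + (s' m + s m + A) * (u - v) - 2 * (s' m + s m) * (u - v) + (A - B) * v"
      by (simp add: algebra_simps)
    finally show ?thesis using A AB E by simp
  qed
qed

definition parity_sign :: "int \<Rightarrow> 'a::comm_ring_1" where
  "parity_sign z = (if even z then 1 else - 1)"

lemma parity_sign_add: "parity_sign (a + b) = parity_sign a * parity_sign b"
  by (simp add: parity_sign_def)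

lemma parity_sign_0: "parity_sign 0 = 1"
  by (simp add: parity_sign_def)

lemma parity_sign_power: "parity_sign a ^ n = parity_sign (a * int n)"
  by (induction n) (simp_all add: parity_sign_0 parity_sign_add algebra_simps)

lemma parity_sign_sum: "parity_sign (\<Sum>i\<in>I. s i) = (\<Prod>i\<in>I. parity_sign (s i))"
  by (induction I rule: infinite_finite_induct) (simp_all add: parity_sign_0 parity_sign_add)

lemma parity_sign_cong: "even (a + b) \<Longrightarrow> parity_sign a = parity_sign b"
  by (auto simp: parity_sign_def)

lemma twisted_monomial:
  fixes y z :: "nat \<Rightarrow> 'a::comm_ring_1"
  assumes "\<And>i. i < k \<Longrightarrow> y i = parity_sign (s i) * z i"
  shows "(\<Prod>i<k. y i ^ e i) = parity_sign (\<Sum>i<k. s i * int (e i)) * (\<Prod>i<k. z i ^ e i)"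
  using assms by (simp add: power_mult_distrib parity_sign_power parity_sign_sum prod.distrib)

text \<open>
  Both monomials of an exchange relation change by the same sign.
\<close>

lemma kernel_exponents:
  assumes "in_kernel k b s" "m < k"
  shows "even ((\<Sum>i<k. s i * int (nat (b i m))) + (\<Sum>i<k. s i * int (nat (- b i m))))"
proof -
  have "(\<Sum>i<k. s i * int (nat (b i m))) - (\<Sum>i<k. s i * int (nat (- b i m))) = (\<Sum>i<k. s i * b i m)"
    unfolding sum_subtractf[symmetric] right_diff_distrib[symmetric] by (intro sum.cong refl) auto
  then have "even ((\<Sum>i<k. s i * int (nat (b i m))) - (\<Sum>i<k. s i * int (nat (- b i m))))"
    using assms by (simp add: in_kernel_def)
  then show ?thesis by simp
qed

section \<open>Sign changes of rational functions\<close>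

definition flip_degree :: "nat set \<Rightarrow> (nat \<Rightarrow>\<^sub>0 nat) \<Rightarrow> nat" where
  "flip_degree S \<alpha> = Sum_any (\<lambda>i. Poly_Mapping.lookup \<alpha> i when i \<in> S)"

lemma flip_degree_add: "flip_degree S (\<alpha> + \<beta>) = flip_degree S \<alpha> + flip_degree S \<beta>"
proof -
  have "finite {i. (Poly_Mapping.lookup \<alpha> i when i \<in> S) \<noteq> 0}" for \<alpha> :: "nat \<Rightarrow>\<^sub>0 nat"
    by (rule finite_subset[OF _ finite_keys[of \<alpha>]]) (auto simp: in_keys_iff when_def split: if_splits)
  then show ?thesis
    by (simp add: flip_degree_def lookup_add when_add_distrib Sum_any.distrib)
qed

lemma flip_degree_0: "flip_degree S 0 = 0"
  by (simp add: flip_degree_def)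

lemma flip_degree_single: "flip_degree S (Poly_Mapping.single i n) = (if i \<in> S then n else 0)"
proof -
  have "(Poly_Mapping.lookup (Poly_Mapping.single i n) j when j \<in> S) = ((if i \<in> S then n else 0) when i = j)" for j
    by (auto simp: lookup_single when_def)
  then show ?thesis unfolding flip_degree_def by (simp only: Sum_any_when_equal')
qed

type_synonym intpoly = "(nat \<Rightarrow>\<^sub>0 nat) \<Rightarrow>\<^sub>0 int"

definition flip_poly :: "nat set \<Rightarrow> intpoly \<Rightarrow> intpoly" where
  "flip_poly S P = Poly_Mapping.mapp (\<lambda>\<alpha> c. (- 1) ^ flip_degree S \<alpha> * c) P"

lemma lookup_flip_poly: "Poly_Mapping.lookup (flip_poly S P) \<alpha> = (- 1) ^ flip_degree S \<alpha> * Poly_Mapping.lookup P \<alpha>"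
  by (simp add: flip_poly_def lookup_mapp when_def in_keys_iff)

lemma flip_poly_add: "flip_poly S (P + R) = flip_poly S P + flip_poly S R"
  by (intro poly_mapping_eqI) (simp add: lookup_flip_poly lookup_add algebra_simps)

lemma flip_poly_uminus: "flip_poly S (- P) = - flip_poly S P"
  by (intro poly_mapping_eqI) (simp add: lookup_flip_poly)

lemma flip_poly_single:
  "flip_poly S (Poly_Mapping.single \<alpha> c) = Poly_Mapping.single \<alpha> ((- 1) ^ flip_degree S \<alpha> * c)"
  by (intro poly_mapping_eqI) (auto simp: lookup_flip_poly lookup_single when_def)

lemma poly_mapping_single_add_induct:
  assumes single: "\<And>\<alpha> c. P (Poly_Mapping.single \<alpha> c)" and add: "\<And>f g. P f \<Longrightarrow> P g \<Longrightarrow> P (f + g)"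
  shows "P f"
proof (induction f rule: update_induct)
  case const
  then show ?case using single[of _ 0] by simp
next
  case (update f \<alpha> c)
  have "Poly_Mapping.update \<alpha> c f = f + Poly_Mapping.single \<alpha> c"
    using update.hyps
    by (intro poly_mapping_eqI) (auto simp: lookup_update lookup_add lookup_single when_def in_keys_iff)
  then show ?case using add single update.IH by simp
qed

lemma flip_poly_mult: "flip_poly S (P * R) = flip_poly S P * flip_poly S R"
proof (induction P rule: poly_mapping_single_add_induct)
  case (1 \<alpha> a)
  show ?case
  proof (induction R rule: poly_mapping_single_add_induct)
    case (1 \<beta> b)
    then show ?case by (simp add: flip_poly_single mult_single flip_degree_add power_add mult_ac)
  next
    case (2 R R')
    then show ?case by (simp add: flip_poly_add distrib_left)
  qed
next
  case (2 P P')
  then show ?case by (simp add: flip_poly_add distrib_right)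
qed

lemma flip_poly_flip_poly: "flip_poly S (flip_poly S P) = P"
proof (intro poly_mapping_eqI)
  fix \<alpha>
  have "((- 1) ^ flip_degree S \<alpha> * (- 1) ^ flip_degree S \<alpha> :: int) = 1"
    by (simp flip: power_mult_distrib)
  then show "Poly_Mapping.lookup (flip_poly S (flip_poly S P)) \<alpha> = Poly_Mapping.lookup P \<alpha>"
    by (simp add: lookup_flip_poly flip: mult.assoc)
qed

lemma flip_poly_0: "flip_poly S 0 = 0"
  by (intro poly_mapping_eqI) (simp add: lookup_flip_poly)

lemma flip_poly_1: "flip_poly S 1 = 1"
  using flip_poly_single[of S 0 1] by (simp add: flip_degree_0)

lemma flip_poly_eq_0_iff: "flip_poly S P = 0 \<longleftrightarrow> P = 0"
  by (metis flip_poly_0 flip_poly_flip_poly)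

text \<open>
  The automorphism of the field of rational functions that negates the indeterminates with index
  in \<open>S\<close>.
\<close>

definition flip :: "nat set \<Rightarrow> ratfun \<Rightarrow> ratfun" where
  "flip S z = (THE w. \<exists>a b. b \<noteq> 0 \<and> z = Fract a b \<and> w = Fract (flip_poly S a) (flip_poly S b))"

lemma flip_Fract: "b \<noteq> 0 \<Longrightarrow> flip S (Fract a b) = Fract (flip_poly S a) (flip_poly S b)"
  unfolding flip_def
proof (rule the_equality)
  fix w
  assume b: "b \<noteq> 0"
    and "\<exists>a' b'. b' \<noteq> 0 \<and> Fract a b = Fract a' b' \<and> w = Fract (flip_poly S a') (flip_poly S b')"
  then obtain a' b' where *: "b' \<noteq> 0" "Fract a b = Fract a' b'" "w = Fract (flip_poly S a') (flip_poly S b')"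
    by blast
  then have "a' * b = a * b'" using b by (simp add: eq_fract)
  then have "flip_poly S a' * flip_poly S b = flip_poly S a * flip_poly S b'"
    by (simp flip: flip_poly_mult)
  then show "w = Fract (flip_poly S a) (flip_poly S b)"
    using b * by (simp add: eq_fract flip_poly_eq_0_iff)
qed blast

lemma flip_hom:
  "flip S 0 = 0" "flip S 1 = 1" "flip S (- x) = - flip S x"
  "flip S (x + y) = flip S x + flip S y" "flip S (x * y) = flip S x * flip S y"
  "flip S (inverse x) = inverse (flip S x)"
proof -
  show "flip S 0 = 0" "flip S 1 = 1"
    by (simp_all add: fract_expand flip_Fract flip_poly_0 flip_poly_1)
  show "flip S (- x) = - flip S x"
    by (cases x) (simp add: flip_Fract flip_poly_uminus)
  show "flip S (x + y) = flip S x + flip S y" "flip S (x * y) = flip S x * flip S y"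
    by (cases x; cases y; simp add: flip_Fract flip_poly_add flip_poly_mult flip_poly_eq_0_iff)+
  show "flip S (inverse x) = inverse (flip S x)"
    by (cases x rule: Fract_cases_nonzero)
       (simp_all add: flip_Fract \<open>flip S 0 = 0\<close>)
qed

lemma flip_divide: "flip S (x / y) = flip S x / flip S y"
  by (simp add: divide_inverse flip_hom)

lemma flip_power: "flip S (x ^ n) = flip S x ^ n"
  by (induction n) (simp_all add: flip_hom)

lemma flip_prod: "flip S (\<Prod>i\<in>I. g i) = (\<Prod>i\<in>I. flip S (g i))"
  by (induction I rule: infinite_finite_induct) (simp_all add: flip_hom)

lemma flip_flip: "flip S (flip S x) = x"
  by (cases x) (simp add: flip_Fract flip_poly_eq_0_iff flip_poly_flip_poly)

lemma flip_indet: "flip S (indet i) = (if i \<in> S then - indet i else indet i)"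
  by (simp add: indet_def flip_Fract flip_poly_single flip_poly_1 flip_degree_single single_uminus)

text \<open>
  Cluster variables are eigenvectors of a sign change from the kernel: by \<open>kernel_exponents\<close> the
  numerator of a mutated variable is multiplied by one common sign, and the new sign vector lies in
  the kernel of the mutated matrix.
\<close>

lemma flip_seed:
  assumes "(x, b) \<in> seeds k Q" and "in_kernel k (exchange_matrix_of Q) (\<lambda>i. of_bool (i \<in> S))"
  shows "\<exists>s. in_kernel k b s \<and> (\<forall>i<k. flip S (x i) = parity_sign (s i) * x i)"
  using assms(1)
proof (induction rule: seeds.induct)
  case initial
  then show ?case using assms(2)
    by (intro exI[of _ "\<lambda>i. of_bool (i \<in> S)"]) (auto simp: flip_indet parity_sign_def)
next
  case (mutate x b m)
  then obtain s where s: "in_kernel k b s" "\<And>i. i < k \<Longrightarrow> flip S (x i) = parity_sign (s i) * x i"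
    by blast
  define e where "e = (\<Sum>i<k. s i * int (nat (b i m)))"
  define s' where "s' = s(m := s m + e)"
  have skew: "skew b" using mutate seeds_skew by blast
  have e: "e = (\<Sum>i<k. s i * max 0 (b i m))"
    unfolding e_def by (intro sum.cong refl) (simp add: max_def)
  have "in_kernel k (mutate_matrix m b) s'"
    by (rule in_kernel_mutate[OF skew \<open>m < k\<close> s(1)]) (simp_all add: s'_def e[symmetric])
  moreover have "flip S (mutate_cluster k m b x i) = parity_sign (s' i) * mutate_cluster k m b x i"
    if "i < k" for i
  proof (cases "i = m")
    case False
    then show ?thesis using s(2)[OF that] by (simp add: mutate_cluster_def s'_def)
  next
    case True
    have 1: "flip S (\<Prod>i<k. x i ^ nat (b i m)) = parity_sign e * (\<Prod>i<k. x i ^ nat (b i m))"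
      unfolding flip_prod flip_power e_def by (rule twisted_monomial) (rule s(2))
    have "flip S (\<Prod>i<k. x i ^ nat (- b i m)) =
        parity_sign (\<Sum>i<k. s i * int (nat (- b i m))) * (\<Prod>i<k. x i ^ nat (- b i m))"
      unfolding flip_prod flip_power by (rule twisted_monomial) (rule s(2))
    also have "parity_sign (\<Sum>i<k. s i * int (nat (- b i m))) = (parity_sign e :: ratfun)"
      using kernel_exponents[OF s(1) \<open>m < k\<close>] by (intro parity_sign_cong) (simp add: e_def add.commute)
    finally have 2: "flip S (\<Prod>i<k. x i ^ nat (- b i m)) = parity_sign e * (\<Prod>i<k. x i ^ nat (- b i m))" .
    have "flip S (mutate_cluster k m b x m) =
        (parity_sign e * ((\<Prod>i<k. x i ^ nat (b i m)) + (\<Prod>i<k. x i ^ nat (- b i m)))) / (parity_sign (s m) * x m)"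
      by (simp only: mutate_cluster_def fun_upd_same flip_divide flip_hom 1 2 s(2)[OF \<open>m < k\<close>] distrib_left)
    also have "\<dots> = parity_sign (s' m) * mutate_cluster k m b x m"
      by (simp add: s'_def mutate_cluster_def parity_sign_def minus_divide_left)
    finally show ?thesis using True by simp
  qed
  ultimately show ?case by blast
qed

section \<open>Friezes and seeds\<close>

lemma cluster_algebra_simps:
  "carrier (cluster_algebra k Q) = generate_ring ring_of_type_algebra (cluster_variables k Q)"
  "monoid.mult (cluster_algebra k Q) = (*)" "monoid.one (cluster_algebra k Q) = 1"
  "ring.zero (cluster_algebra k Q) = 0" "ring.add (cluster_algebra k Q) = (+)"
  by (simp_all add: cluster_algebra_def ring_of_type_algebra_def)

lemma a_inv_ring_of_type_algebra: "\<ominus>\<^bsub>ring_of_type_algebra\<^esub> (x :: ratfun) = - x"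
proof -
  interpret ring "ring_of_type_algebra :: ratfun ring" by (rule ring_from_type_algebra)
  show ?thesis by (rule minus_equality) (simp_all add: ring_of_type_algebra_def)
qed

lemma cluster_algebra_closed:
  fixes k Q
  defines "A \<equiv> carrier (cluster_algebra k Q)"
  shows "x \<in> cluster_variables k Q \<Longrightarrow> x \<in> A" "1 \<in> A" "x \<in> A \<Longrightarrow> - x \<in> A"
    "x \<in> A \<Longrightarrow> y \<in> A \<Longrightarrow> x + y \<in> A" "x \<in> A \<Longrightarrow> y \<in> A \<Longrightarrow> x * y \<in> A"
proof -
  let ?R = "ring_of_type_algebra :: ratfun ring"
  have R: "monoid.mult ?R = (*)" "monoid.one ?R = 1" "ring.add ?R = (+)" by (simp_all add: ring_of_type_algebra_def)
  note G = generate_ring.intros[where R = ?R and H = "cluster_variables k Q", unfolded R a_inv_ring_of_type_algebra]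
  show "x \<in> cluster_variables k Q \<Longrightarrow> x \<in> A" "1 \<in> A" "x \<in> A \<Longrightarrow> - x \<in> A"
    "x \<in> A \<Longrightarrow> y \<in> A \<Longrightarrow> x + y \<in> A" "x \<in> A \<Longrightarrow> y \<in> A \<Longrightarrow> x * y \<in> A"
    unfolding A_def cluster_algebra_simps by (blast intro: G)+
qed

lemma cluster_algebra_induct [consumes 1, case_names var one uminus add mult]:
  assumes "z \<in> carrier (cluster_algebra k Q)"
    and "\<And>x. x \<in> cluster_variables k Q \<Longrightarrow> P x" and "P 1"
    and "\<And>x. x \<in> carrier (cluster_algebra k Q) \<Longrightarrow> P x \<Longrightarrow> P (- x)"
    and "\<And>x y. x \<in> carrier (cluster_algebra k Q) \<Longrightarrow> y \<in> carrier (cluster_algebra k Q) \<Longrightarrow>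
      P x \<Longrightarrow> P y \<Longrightarrow> P (x + y)"
    and "\<And>x y. x \<in> carrier (cluster_algebra k Q) \<Longrightarrow> y \<in> carrier (cluster_algebra k Q) \<Longrightarrow>
      P x \<Longrightarrow> P y \<Longrightarrow> P (x * y)"
  shows "P z"
  using assms(1) unfolding cluster_algebra_simps
proof (induction rule: generate_ring.induct)
  case one
  then show ?case using assms(3) by (simp add: ring_of_type_algebra_def)
next
  case (incl h)
  then show ?case by (rule assms(2))
next
  case (a_inv h)
  then show ?case using assms(4) by (simp add: a_inv_ring_of_type_algebra cluster_algebra_simps)
next
  case (eng_add x y)
  then show ?case using assms(5)[of x y] by (simp add: cluster_algebra_simps) (simp add: ring_of_type_algebra_def)
next
  case (eng_mult x y)
  then show ?case using assms(6)[of x y] by (simp add: cluster_algebra_simps) (simp add: ring_of_type_algebra_def)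
qed

lemma integral_hom_iff:
  "f \<in> integral_homs k Q \<longleftrightarrow>
     f 1 = 1 \<and> f \<in> extensional (carrier (cluster_algebra k Q)) \<and>
     (\<forall>x\<in>carrier (cluster_algebra k Q). \<forall>y\<in>carrier (cluster_algebra k Q).
        f (x + y) = f x + f y \<and> f (x * y) = f x * f y)"
  unfolding integral_homs_def ring_hom_def by (auto simp: cluster_algebra_simps(2-))

lemma integral_hom_minus:
  assumes f: "f \<in> integral_homs k Q" and x: "x \<in> carrier (cluster_algebra k Q)"
  shows "f (- x) = - f x"
proof -
  let ?A = "carrier (cluster_algebra k Q)"
  have add: "f (y + z) = f y + f z" if "y \<in> ?A" "z \<in> ?A" for y z
    using f that unfolding integral_hom_iff by blast
  have 0: "0 \<in> ?A" using cluster_algebra_closed(4)[OF x cluster_algebra_closed(3)[OF x]] by simp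
  have "f 0 = 0" using add[OF 0 0] by simp
  then show ?thesis using add[OF x cluster_algebra_closed(3)[OF x]] by simp
qed

lemma integral_hom_eqI:
  assumes f: "f \<in> integral_homs k Q" and g: "g \<in> integral_homs k Q"
    and eq: "\<And>x. x \<in> cluster_variables k Q \<Longrightarrow> f x = g x"
  shows "f = g"
proof (rule extensionalityI)
  show "f \<in> extensional (carrier (cluster_algebra k Q))" "g \<in> extensional (carrier (cluster_algebra k Q))"
    using f g by (simp_all add: integral_hom_iff)
  show "f z = g z" if "z \<in> carrier (cluster_algebra k Q)" for z
    using that
  proof (induction rule: cluster_algebra_induct)
    case (uminus x)
    then show ?case using integral_hom_minus[OF f] integral_hom_minus[OF g] by simp
  qed (use f g eq in \<open>simp_all add: integral_hom_iff\<close>)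
qed

lemma cluster_variableI: "(x, b) \<in> seeds k Q \<Longrightarrow> i < k \<Longrightarrow> x i \<in> cluster_variables k Q"
  unfolding cluster_variables_def by blast

lemma indet_cluster_variable: "i < k \<Longrightarrow> indet i \<in> cluster_variables k Q"
  by (rule cluster_variableI[OF seeds.initial])

lemma integral_hom_monomial:
  assumes f: "f \<in> integral_homs k Q" and x: "(x, b) \<in> seeds k Q"
  shows "(\<Prod>i<k. x i ^ e i) \<in> carrier (cluster_algebra k Q) \<and> f (\<Prod>i<k. x i ^ e i) = (\<Prod>i<k. f (x i) ^ e i)"
proof -
  let ?A = "carrier (cluster_algebra k Q)"
  have mult: "f (y * z) = f y * f z" if "y \<in> ?A" "z \<in> ?A" for y z
    using f that unfolding integral_hom_iff by blast
  have one: "f 1 = 1" using f by (simp add: integral_hom_iff)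
  have pow: "x i ^ n \<in> ?A \<and> f (x i ^ n) = f (x i) ^ n" if "i < k" for i n
    using cluster_algebra_closed(1)[OF cluster_variableI[OF x that]]
    by (induction n) (auto simp: one mult cluster_algebra_closed)
  have "(\<Prod>i<j. x i ^ e i) \<in> ?A \<and> f (\<Prod>i<j. x i ^ e i) = (\<Prod>i<j. f (x i) ^ e i)" if "j \<le> k" for j
    using that
  proof (induction j)
    case 0
    then show ?case by (simp add: one cluster_algebra_closed)
  next
    case (Suc j)
    then show ?case using pow[of j "e j"] by (auto simp: mult cluster_algebra_closed)
  qed
  then show ?thesis by blast
qed

lemma nonzero_friezeD:
  assumes "f \<in> nonzero_friezes k Q"
  shows "f \<in> integral_homs k Q" "(x, b) \<in> seeds k Q \<Longrightarrow> i < k \<Longrightarrow> f (x i) \<noteq> 0"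
  using assms cluster_variableI unfolding nonzero_friezes_def by blast+

lemma positive_frieze_nonzero: "f \<in> positive_friezes k Q \<Longrightarrow> f \<in> nonzero_friezes k Q"
  unfolding positive_friezes_def nonzero_friezes_def by force

text \<open>
  Cluster variables are invertible in the field because a frieze does not vanish on them.
\<close>

lemma frieze_exchange:
  assumes f: "f \<in> nonzero_friezes k Q" and x: "(x, b) \<in> seeds k Q" and m: "m < k"
  shows "f (x m) * f (mutate_cluster k m b x m) =
    (\<Prod>i<k. f (x i) ^ nat (b i m)) + (\<Prod>i<k. f (x i) ^ nat (- b i m))"
proof -
  note hom = nonzero_friezeD(1)[OF f]
  let ?A = "carrier (cluster_algebra k Q)" and ?x' = "mutate_cluster k m b x"
  have add: "f (y + z) = f y + f z" and mult: "f (y * z) = f y * f z" if "y \<in> ?A" "z \<in> ?A" for y z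
    using hom that unfolding integral_hom_iff by blast+
  have xm: "x m \<in> ?A" and x'm: "?x' m \<in> ?A"
    using cluster_algebra_closed(1) cluster_variableI x seeds.mutate[OF x m] m by blast+
  have "f 0 = 0"
    using integral_hom_minus[OF hom cluster_algebra_closed(2)] add[OF cluster_algebra_closed(2,3)]
      cluster_algebra_closed(2,3) by (metis add.right_inverse)
  then have "x m \<noteq> 0" using nonzero_friezeD(2)[OF f x m] by metis
  then have "x m * ?x' m = (\<Prod>i<k. x i ^ nat (b i m)) + (\<Prod>i<k. x i ^ nat (- b i m))"
    by (simp add: mutate_cluster_def)
  then have "f (x m * ?x' m) = f ((\<Prod>i<k. x i ^ nat (b i m)) + (\<Prod>i<k. x i ^ nat (- b i m)))"
    by simp
  then show ?thesis
    using integral_hom_monomial[OF hom x] by (simp add: add mult xm x'm)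
qed

lemma mutated_monomial:
  assumes "b m m = (0 :: int)"
  shows "(\<Prod>i<k. f (mutate_cluster k m b x i) ^ nat (b i m)) = (\<Prod>i<k. f (x i) ^ nat (b i m))"
    "(\<Prod>i<k. f (mutate_cluster k m b x i) ^ nat (- b i m)) = (\<Prod>i<k. f (x i) ^ nat (- b i m))"
  using assms by (auto simp: mutate_cluster_def intro!: prod.cong)

lemma mutate_cluster_other: "i \<noteq> m \<Longrightarrow> mutate_cluster k m b x i = x i"
  by (simp add: mutate_cluster_def)

text \<open>
  The two monomials of an exchange relation do not contain the mutated variable, so the relation
  determines the old value from the new cluster just as it determines the new value from the old
  cluster.
\<close>

lemma friezes_agree_initially:
  assumes f: "f \<in> nonzero_friezes k Q" and g: "g \<in> nonzero_friezes k Q"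
    and "(x, b) \<in> seeds k Q" and "\<forall>i<k. f (x i) = g (x i)"
  shows "\<forall>i<k. f (indet i) = g (indet i)"
  using assms(3,4)
proof (induction rule: seeds.induct)
  case (mutate x b m)
  have bm: "b m m = 0" using seeds_skew[OF mutate.hyps(1)] by (rule skew_diag)
  have "f (x i) = g (x i)" if i: "i < k" for i
  proof (cases "i = m")
    case False
    then show ?thesis using mutate.prems[rule_format, OF i] by (simp add: mutate_cluster_other)
  next
    case True
    have "f (x m) * f (mutate_cluster k m b x m) = g (x m) * g (mutate_cluster k m b x m)"
      unfolding frieze_exchange[OF f mutate.hyps] frieze_exchange[OF g mutate.hyps]
        mutated_monomial[where b = b and m = m and x = x, OF bm, symmetric]
      using mutate.prems by simp
    moreover have "g (mutate_cluster k m b x m) \<noteq> 0"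
      by (rule nonzero_friezeD(2)[OF g seeds.mutate[OF mutate.hyps] mutate.hyps(2)])
    ultimately show ?thesis using mutate.prems mutate.hyps(2) True by simp
  qed
  then show ?case using mutate.IH by blast
qed

lemma friezes_agree_on_seed:
  assumes f: "f \<in> nonzero_friezes k Q" and g: "g \<in> nonzero_friezes k Q"
    and "(x, b) \<in> seeds k Q" and init: "\<forall>i<k. f (indet i) = g (indet i)"
  shows "\<forall>i<k. f (x i) = g (x i)"
  using assms(3)
proof (induction rule: seeds.induct)
  case (mutate x b m)
  have "f (mutate_cluster k m b x i) = g (mutate_cluster k m b x i)" if i: "i < k" for i
  proof (cases "i = m")
    case False
    then show ?thesis using mutate.IH i by (simp add: mutate_cluster_other)
  next
    case True
    have "f (x m) * f (mutate_cluster k m b x m) = g (x m) * g (mutate_cluster k m b x m)"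
      unfolding frieze_exchange[OF f mutate.hyps] frieze_exchange[OF g mutate.hyps]
      using mutate.IH by simp
    moreover have "g (x m) \<noteq> 0" by (rule nonzero_friezeD(2)[OF g mutate.hyps])
    ultimately show ?thesis using mutate.IH mutate.hyps(2) True by simp
  qed
  then show ?case by blast
qed (use init in blast)

lemma frieze_determined_by_seed:
  assumes f: "f \<in> nonzero_friezes k Q" and g: "g \<in> nonzero_friezes k Q"
    and x: "(x, b) \<in> seeds k Q" and eq: "\<forall>i<k. f (x i) = g (x i)"
  shows "f = g"
proof (rule integral_hom_eqI)
  show "f \<in> integral_homs k Q" by (rule nonzero_friezeD(1)[OF f])
  show "g \<in> integral_homs k Q" by (rule nonzero_friezeD(1)[OF g])
  show "f z = g z" if "z \<in> cluster_variables k Q" for z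
    using that friezes_agree_on_seed[OF f g _ friezes_agree_initially[OF f g x eq]]
    unfolding cluster_variables_def by blast
qed

lemma frieze_positive_if_initially:
  assumes f: "f \<in> nonzero_friezes k Q" and init: "\<forall>i<k. 0 < f (indet i)"
  shows "f \<in> positive_friezes k Q"
proof -
  have "\<forall>i<k. 0 < f (x i)" if "(x, b) \<in> seeds k Q" for x b
    using that
  proof (induction rule: seeds.induct)
    case (mutate x b m)
    have "0 < f (x m) * f (mutate_cluster k m b x m)"
      unfolding frieze_exchange[OF f mutate.hyps] using mutate.IH
      by (intro add_pos_pos prod_pos) auto
    moreover have "0 < f (x m)" using mutate.IH mutate.hyps(2) by blast
    ultimately have pos: "0 < f (mutate_cluster k m b x m)" by (rule zero_less_mult_pos)
    show ?case
    proof (intro allI impI)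
      show "0 < f (mutate_cluster k m b x i)" if "i < k" for i
        using pos mutate.IH that by (cases "i = m") (simp_all add: mutate_cluster_other)
    qed
  qed (use init in blast)
  then have "\<forall>z\<in>cluster_variables k Q. 0 < f z" unfolding cluster_variables_def by blast
  then show ?thesis using nonzero_friezeD(1)[OF f] by (simp add: positive_friezes_def)
qed

abbreviation neg_bit :: "int \<Rightarrow> int" where
  "neg_bit y \<equiv> of_bool (y < 0)"

lemma signed_abs: "y = parity_sign (neg_bit y) * \<bar>y\<bar>" for y :: int
  by (simp add: parity_sign_def)

text \<open>
  Mutation is an involution, so a kernel vector at the mutated seed gives one at the original seed.
  That the mutated sign vector is the actual sign vector of \<open>f\<close> holds because both exchange
  monomials have the same sign, which is then also the sign of their sum.
\<close>

lemma balanced_signs_initially: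
  assumes f: "f \<in> nonzero_friezes k Q"
    and "(x, b) \<in> seeds k Q" and "in_kernel k b (\<lambda>i. neg_bit (f (x i)))"
  shows "in_kernel k (exchange_matrix_of Q) (\<lambda>i. neg_bit (f (indet i)))"
  using assms(2,3)
proof (induction rule: seeds.induct)
  case (mutate x b m)
  let ?x' = "mutate_cluster k m b x" and ?b' = "mutate_matrix m b"
  have x': "(?x', ?b') \<in> seeds k Q" by (rule seeds.mutate[OF mutate.hyps])
  have skew': "skew ?b'" by (rule seeds_skew[OF x'])
  have bm: "b m m = 0" using seeds_skew[OF mutate.hyps(1)] by (rule skew_diag)
  have b': "?b' i m = - b i m" for i by (simp add: mutate_matrix_def)
  let ?s' = "\<lambda>i. neg_bit (f (?x' i))" and ?s = "\<lambda>i. neg_bit (f (x i))"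
  define e where "e = (\<Sum>i<k. ?s' i * int (nat (- b i m)))"
  define M where "M = (\<Prod>i<k. \<bar>f (?x' i)\<bar> ^ nat (b i m)) + (\<Prod>i<k. \<bar>f (?x' i)\<bar> ^ nat (- b i m))"
  have nz: "f (?x' i) \<noteq> 0" if "i < k" for i using nonzero_friezeD(2)[OF f x' that] .
  have "0 < M" unfolding M_def using nz by (intro add_pos_pos prod_pos) auto
  have par: "(parity_sign (\<Sum>i<k. ?s' i * int (nat (b i m))) :: int) = parity_sign e"
    using kernel_exponents[OF mutate.prems mutate.hyps(2)]
    by (intro parity_sign_cong) (simp add: b' e_def add.commute)
  have "f (x m) * f (?x' m) = parity_sign e * M"
    unfolding frieze_exchange[OF f mutate.hyps] mutated_monomial[where b = b and m = m and x = x, OF bm, symmetric] M_def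
      distrib_left
    using twisted_monomial[of k "\<lambda>i. f (?x' i)" ?s' "\<lambda>i. \<bar>f (?x' i)\<bar>"] signed_abs par
    by (simp add: e_def)
  moreover have "f (x m) * f (?x' m) = parity_sign (?s m + ?s' m) * (\<bar>f (x m)\<bar> * \<bar>f (?x' m)\<bar>)"
    unfolding parity_sign_add using signed_abs[of "f (x m)"] signed_abs[of "f (?x' m)"]
    by (metis (no_types, lifting) mult.assoc mult.left_commute)
  moreover have "0 < \<bar>f (x m)\<bar> * \<bar>f (?x' m)\<bar>"
    using nz mutate.hyps(2) nonzero_friezeD(2)[OF f mutate.hyps] by simp
  ultimately have *: "even (?s m + ?s' m + e)"
    using \<open>0 < M\<close> by (auto simp: parity_sign_def split: if_splits)
  have e: "e = (\<Sum>i<k. ?s' i * max 0 (?b' i m))"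
    unfolding e_def b' by (intro sum.cong refl) (simp add: max_def)
  have "in_kernel k (mutate_matrix m ?b') ?s"
    by (rule in_kernel_mutate[OF skew' mutate.hyps(2) mutate.prems])
       (use * in \<open>simp_all add: mutate_cluster_other e[symmetric]\<close>)
  then show ?case using mutate.IH by (simp add: mutate_matrix_involutive)
qed

section \<open>Sign changes of friezes\<close>

definition sign_changes :: "nat \<Rightarrow> (nat \<times> nat) set \<Rightarrow> nat set set" where
  "sign_changes k Q = {S. S \<subseteq> {..<k} \<and> in_kernel k (exchange_matrix_of Q) (\<lambda>i. of_bool (i \<in> S))}"

definition flip_frieze :: "nat \<Rightarrow> (nat \<times> nat) set \<Rightarrow> nat set \<Rightarrow> (ratfun \<Rightarrow> int) \<Rightarrow> ratfun \<Rightarrow> int" where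
  "flip_frieze k Q S f = restrict (\<lambda>z. f (flip S z)) (carrier (cluster_algebra k Q))"

lemma flip_cluster_variable:
  assumes "S \<in> sign_changes k Q" "z \<in> cluster_variables k Q"
  shows "flip S z = z \<or> flip S z = - z"
proof -
  obtain x b i where x: "(x, b) \<in> seeds k Q" "i < k" "z = x i"
    using assms(2) unfolding cluster_variables_def by blast
  show ?thesis using flip_seed[OF x(1), of S] assms(1) x(2,3)
    by (auto simp: sign_changes_def parity_sign_def split: if_splits)
qed

lemma flip_closed:
  assumes S: "S \<in> sign_changes k Q" and "z \<in> carrier (cluster_algebra k Q)"
  shows "flip S z \<in> carrier (cluster_algebra k Q)"
  using assms(2)
proof (induction rule: cluster_algebra_induct)
  case (var x)
  then show ?case
    using flip_cluster_variable[OF S var] cluster_algebra_closed(1,3) by metis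
qed (simp_all add: flip_hom cluster_algebra_closed)

lemma flip_frieze_nonzero:
  assumes S: "S \<in> sign_changes k Q" and f: "f \<in> nonzero_friezes k Q"
  shows "flip_frieze k Q S f \<in> nonzero_friezes k Q"
proof -
  note hom = nonzero_friezeD(1)[OF f]
  have "flip_frieze k Q S f \<in> integral_homs k Q"
    using hom flip_closed[OF S] unfolding integral_hom_iff flip_frieze_def
    by (simp add: cluster_algebra_closed flip_hom)
  moreover have "flip_frieze k Q S f z \<noteq> 0" if z: "z \<in> cluster_variables k Q" for z
  proof -
    have A: "z \<in> carrier (cluster_algebra k Q)" using cluster_algebra_closed(1)[OF z] .
    have "f z \<noteq> 0" using f z by (simp add: nonzero_friezes_def)
    then show ?thesis
      using flip_cluster_variable[OF S z] integral_hom_minus[OF hom A] A by (auto simp: flip_frieze_def)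
  qed
  ultimately show ?thesis by (simp add: nonzero_friezes_def)
qed

lemma flip_frieze_indet:
  assumes f: "f \<in> nonzero_friezes k Q" and i: "i < k"
  shows "flip_frieze k Q S f (indet i) = (if i \<in> S then - f (indet i) else f (indet i))"
proof -
  have A: "indet i \<in> carrier (cluster_algebra k Q)"
    using cluster_algebra_closed(1) indet_cluster_variable[OF i] by blast
  then show ?thesis
    using integral_hom_minus[OF nonzero_friezeD(1)[OF f] A] by (simp add: flip_frieze_def flip_indet)
qed

lemma flip_frieze_involutive:
  assumes S: "S \<in> sign_changes k Q" and f: "f \<in> nonzero_friezes k Q"
  shows "flip_frieze k Q S (flip_frieze k Q S f) = f"
proof (rule extensionalityI)
  show "f \<in> extensional (carrier (cluster_algebra k Q))"
    using nonzero_friezeD(1)[OF f] by (simp add: integral_hom_iff)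
qed (simp_all add: flip_frieze_def flip_closed[OF S] flip_flip)

text \<open>
  The sign change is recovered from the initial values, which are positive before it is applied.
  Conversely, the signs of the initial values of a non-zero frieze are the sign change that makes
  it positive.
\<close>

lemma flip_frieze_bij_betw:
  assumes balanced: "\<And>f. f \<in> nonzero_friezes k Q \<Longrightarrow>
      \<exists>x. (x, exchange_matrix_of Q) \<in> seeds k Q \<and> in_kernel k (exchange_matrix_of Q) (\<lambda>i. neg_bit (f (x i)))"
  shows "bij_betw (\<lambda>(S, f). flip_frieze k Q S f) (sign_changes k Q \<times> positive_friezes k Q) (nonzero_friezes k Q)"
proof (rule bij_betw_imageI)
  have val: "flip_frieze k Q S f (indet i) = (if i \<in> S then - f (indet i) else f (indet i))"
    and pos: "0 < f (indet i)" if "f \<in> positive_friezes k Q" "i < k" for S f i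
    using flip_frieze_indet[OF positive_frieze_nonzero] that indet_cluster_variable
    by (auto simp: positive_friezes_def)
  show "inj_on (\<lambda>(S, f). flip_frieze k Q S f) (sign_changes k Q \<times> positive_friezes k Q)"
  proof (rule inj_onI, clarify)
    fix S f S' f'
    assume S: "S \<in> sign_changes k Q" "S' \<in> sign_changes k Q"
      and f: "f \<in> positive_friezes k Q" "f' \<in> positive_friezes k Q"
      and eq: "flip_frieze k Q S f = flip_frieze k Q S' f'"
    have *: "(i \<in> S \<longleftrightarrow> i \<in> S') \<and> f (indet i) = f' (indet i)" if i: "i < k" for i
      using fun_cong[OF eq, of "indet i"] val[OF f(1) i, of S] val[OF f(2) i, of S'] pos[OF f(1) i] pos[OF f(2) i]
      by (auto split: if_splits)
    then have "S = S'" using S unfolding sign_changes_def by blast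
    moreover have "f = f'"
      by (rule frieze_determined_by_seed[OF f[THEN positive_frieze_nonzero] seeds.initial]) (use * in blast)
    ultimately show "S = S' \<and> f = f'" ..
  qed
  show "(\<lambda>(S, f). flip_frieze k Q S f) ` (sign_changes k Q \<times> positive_friezes k Q) = nonzero_friezes k Q"
  proof (intro equalityI subsetI)
    fix g assume "g \<in> (\<lambda>(S, f). flip_frieze k Q S f) ` (sign_changes k Q \<times> positive_friezes k Q)"
    then show "g \<in> nonzero_friezes k Q" using flip_frieze_nonzero positive_frieze_nonzero by auto
  next
    fix f assume f: "f \<in> nonzero_friezes k Q"
    define S where "S = {i. i < k \<and> f (indet i) < 0}"
    obtain x where x: "(x, exchange_matrix_of Q) \<in> seeds k Q"
      "in_kernel k (exchange_matrix_of Q) (\<lambda>i. neg_bit (f (x i)))"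
      using balanced[OF f] by blast
    have "in_kernel k (exchange_matrix_of Q) (\<lambda>i. neg_bit (f (indet i)))"
      by (rule balanced_signs_initially[OF f x])
    moreover have "(\<Sum>i<k. neg_bit (f (indet i)) * b i) = (\<Sum>i<k. of_bool (i \<in> S) * b i)" for b
      by (intro sum.cong refl) (simp add: S_def)
    ultimately have "in_kernel k (exchange_matrix_of Q) (\<lambda>i. of_bool (i \<in> S))"
      by (simp only: in_kernel_def)
    moreover have "S \<subseteq> {..<k}" by (auto simp: S_def)
    ultimately have S: "S \<in> sign_changes k Q" by (simp add: sign_changes_def)
    have g: "flip_frieze k Q S f \<in> nonzero_friezes k Q" by (rule flip_frieze_nonzero[OF S f])
    have "0 < flip_frieze k Q S f (indet i)" if i: "i < k" for i
      using flip_frieze_indet[OF f i, of S] nonzero_friezeD(2)[OF f seeds.initial i] i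
      by (auto simp: S_def)
    then have "flip_frieze k Q S f \<in> positive_friezes k Q"
      using frieze_positive_if_initially[OF g] by blast
    then show "f \<in> (\<lambda>(S, f). flip_frieze k Q S f) ` (sign_changes k Q \<times> positive_friezes k Q)"
      using flip_frieze_involutive[OF S f] S by (intro image_eqI[of _ _ "(S, flip_frieze k Q S f)"]) auto
  qed
qed

section \<open>Sign changes of type D\<close>

lemma D_nbrs_orientation:
  assumes "orientation_of (dynkin_D k) Q"
  shows "j \<in> D_nbrs k i \<longleftrightarrow> (i, j) \<in> Q \<or> (j, i) \<in> Q" "(i, j) \<in> Q \<Longrightarrow> (j, i) \<notin> Q"
  using assms unfolding orientation_of_def D_nbrs_def by blast+

text \<open>
  Modulo 2 the orientation is invisible: the exchange matrix is the adjacency matrix of the diagram.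
\<close>

lemma in_kernel_D_iff:
  assumes Q: "orientation_of (dynkin_D (m + 4)) Q"
  shows "in_kernel (m + 4) (exchange_matrix_of Q) s \<longleftrightarrow>
    (\<forall>i<m + 4. even (\<Sum>j\<in>D_nbrs (m + 4) i. s j))"
proof -
  have "even (\<Sum>j<m + 4. s j * exchange_matrix_of Q j i) \<longleftrightarrow> even (\<Sum>j\<in>D_nbrs (m + 4) i. s j)" for i
  proof -
    have fin: "finite (D_nbrs (m + 4) i)"
      by (rule finite_subset[of _ "{..<m + 4}"]) (auto dest: D_nbrs_less)
    have "(\<Sum>j<m + 4. s j * exchange_matrix_of Q j i) = (\<Sum>j\<in>D_nbrs (m + 4) i. s j * exchange_matrix_of Q j i)"
      using D_nbrs_orientation(1)[OF Q]
      by (intro sum.mono_neutral_right) (auto simp: exchange_matrix_of_def dest: D_nbrs_less)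
    also have "\<dots> + (\<Sum>j\<in>D_nbrs (m + 4) i. s j) = (\<Sum>j\<in>D_nbrs (m + 4) i. s j * (exchange_matrix_of Q j i + 1))"
      by (simp add: sum.distrib algebra_simps)
    also have "even \<dots>"
      using D_nbrs_orientation[OF Q]
      by (intro dvd_sum dvd_mult) (auto simp: exchange_matrix_of_def)
    finally show ?thesis by simp
  qed
  then show ?thesis by (simp add: in_kernel_def)
qed

lemma sign_changes_D_iff:
  assumes Q: "orientation_of (dynkin_D (m + 4)) Q"
  shows "S \<in> sign_changes (m + 4) Q \<longleftrightarrow>
    S \<subseteq> {..<m + 4} \<and> 1 \<notin> S \<and> m + 1 \<notin> S \<and> (\<forall>i<m. i \<in> S \<longleftrightarrow> i + 2 \<in> S) \<and>
    (m \<in> S \<longleftrightarrow> (m + 2 \<in> S) \<noteq> (m + 3 \<in> S))"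
proof -
  define s :: "nat \<Rightarrow> int" where "s j = of_bool (j \<in> S)" for j
  define P where "P i \<longleftrightarrow> even (\<Sum>j\<in>D_nbrs (m + 4) i. s j)" for i
  have s: "even (s j) \<longleftrightarrow> j \<notin> S" for j by (simp add: s_def)
  have P: "P 0 \<longleftrightarrow> 1 \<notin> S" "P (m + 2) \<longleftrightarrow> m + 1 \<notin> S" "P (m + 3) \<longleftrightarrow> m + 1 \<notin> S"
    "P (m + 1) \<longleftrightarrow> (m \<in> S \<longleftrightarrow> (m + 2 \<in> S) \<noteq> (m + 3 \<in> S))"
    unfolding P_def D_nbrs_simps(1,3-5) by (auto simp: s)
  have Pi: "P (Suc i) \<longleftrightarrow> (i \<in> S \<longleftrightarrow> i + 2 \<in> S)" if "i < m" for i
    unfolding P_def using that by (subst D_nbrs_simps(2)) (auto simp: s)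
  have "(\<forall>i<m + 4. P i) \<longleftrightarrow> P 0 \<and> (\<forall>i<m. P (Suc i)) \<and> P (m + 1) \<and> P (m + 2) \<and> P (m + 3)"
  proof (intro iffI allI impI)
    fix i assume *: "P 0 \<and> (\<forall>i<m. P (Suc i)) \<and> P (m + 1) \<and> P (m + 2) \<and> P (m + 3)" and i: "i < m + 4"
    show "P i"
      using i by (cases rule: D_vertex_cases) (use * in \<open>auto simp: gr0_conv_Suc\<close>)
  qed auto
  moreover have "(\<forall>i<m. P (Suc i)) \<longleftrightarrow> (\<forall>i<m. i \<in> S \<longleftrightarrow> i + 2 \<in> S)" using Pi by blast
  ultimately have "(\<forall>i<m + 4. P i) \<longleftrightarrow> 1 \<notin> S \<and> (\<forall>i<m. i \<in> S \<longleftrightarrow> i + 2 \<in> S) \<and>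
      (m \<in> S \<longleftrightarrow> (m + 2 \<in> S) \<noteq> (m + 3 \<in> S)) \<and> m + 1 \<notin> S"
    using P by blast
  then show ?thesis
    unfolding sign_changes_def in_kernel_D_iff[OF Q] P_def s_def by blast
qed

text \<open>
  The kernel condition at the inner vertices of the long arm makes membership 2-periodic along the
  arm, the leaf \<open>0\<close> excludes the odd vertices, and each leaf of the fork excludes \<open>m + 1\<close>.  If \<open>m\<close> is even,
  the two leaves of the fork are free and determine the even vertices; if \<open>m\<close> is odd, the arm is
  empty and the two leaves agree.
\<close>

lemma card_sign_changes_D:
  assumes Q: "orientation_of (dynkin_D (m + 4)) Q"
  shows "card (sign_changes (m + 4) Q) = (if even m then 4 else 2)"
proof -
  let ?K = "sign_changes (m + 4) Q"
  have per: "i \<in> S \<longleftrightarrow> i mod 2 \<in> S" if "S \<in> ?K" "i \<le> m + 1" for S i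
    using that(2)
  proof (induction i rule: less_induct)
    case (less i)
    show ?case
    proof (cases "i < 2")
      case False
      then obtain j where j: "i = j + 2" by (metis add.commute le_Suc_ex not_less)
      then have "j \<in> S \<longleftrightarrow> i \<in> S" using that(1) less.prems by (auto simp: sign_changes_D_iff[OF Q])
      then show ?thesis using less.IH[of j] less.prems j by simp
    qed simp
  qed
  have top: "i \<in> S \<Longrightarrow> i \<le> m + 1 \<or> i = m + 2 \<or> i = m + 3" if "S \<in> ?K" for S i
  proof -
    assume "i \<in> S"
    then have "i < m + 4" using that by (auto simp: sign_changes_def)
    then show ?thesis by linarith
  qed
  have K: "1 \<notin> S" "m + 1 \<notin> S" "m \<in> S \<longleftrightarrow> (m + 2 \<in> S) \<noteq> (m + 3 \<in> S)" if "S \<in> ?K" for S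
    using that unfolding sign_changes_D_iff[OF Q] by blast+
  show ?thesis
  proof (cases "even m")
    case True
    define Z where "Z = (\<lambda>(u, v). {i. even i \<and> i \<le> m \<and> u \<noteq> v} \<union> {i. i = m + 2 \<and> u} \<union> {i. i = m + 3 \<and> v})"
    have "?K = range Z"
    proof (intro equalityI subsetI)
      fix S assume S: "S \<in> ?K"
      have low: "i \<in> S \<longleftrightarrow> even i \<and> i \<le> m \<and> (m + 2 \<in> S) \<noteq> (m + 3 \<in> S)" if "i \<le> m + 1" for i
      proof (cases "even i")
        case True
        then have "i \<le> m" using that \<open>even m\<close> by (metis Suc_eq_plus1 even_Suc le_SucE)
        moreover have "i \<in> S \<longleftrightarrow> m \<in> S" using per[OF S that] per[OF S, of m] True \<open>even m\<close> by (simp add: even_iff_mod_2_eq_zero)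
        ultimately show ?thesis using True K(3)[OF S] by simp
      next
        case False
        then show ?thesis using per[OF S that] K(1)[OF S] by (simp add: odd_iff_mod_2_eq_one)
      qed
      have "i \<in> S \<longleftrightarrow> i \<in> Z (m + 2 \<in> S, m + 3 \<in> S)" for i
        using low[of i] top[OF S, of i] by (auto simp: Z_def)
      then show "S \<in> range Z" by blast
    next
      fix S assume "S \<in> range Z"
      then obtain u v where "S = Z (u, v)" by auto
      moreover have "Suc (Suc i) \<le> m" if "even i" "i < m" for i
        using that True by presburger
      ultimately show "S \<in> ?K" using True unfolding sign_changes_D_iff[OF Q] by (auto simp: Z_def)
    qed
    moreover have "inj Z"
    proof (rule injI, clarify)
      fix u v u' v' assume eq: "Z (u, v) = Z (u', v')"
      show "u = u' \<and> v = v'"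
        using arg_cong[OF eq, of "\<lambda>A. m + 2 \<in> A"] arg_cong[OF eq, of "\<lambda>A. m + 3 \<in> A"] by (auto simp: Z_def)
    qed
    ultimately have "card ?K = card (UNIV :: (bool \<times> bool) set)" by (simp add: card_image)
    then show ?thesis using True by (simp add: card_UNIV_bool flip: UNIV_Times_UNIV)
  next
    case False
    have "?K = {{}, {m + 2, m + 3}}"
    proof (intro equalityI subsetI)
      fix S assume S: "S \<in> ?K"
      have low: "i \<notin> S" if "i \<le> m + 1" for i
      proof (cases "even i")
        case True
        then show ?thesis using per[OF S that] per[OF S, of "m + 1"] K(2)[OF S] False
          by (auto simp: even_iff_mod_2_eq_zero mod_Suc)
      next
        case odd: False
        then show ?thesis using per[OF S that] K(1)[OF S] by (simp add: odd_iff_mod_2_eq_one)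
      qed
      have "m + 2 \<in> S \<longleftrightarrow> m + 3 \<in> S" using K(3)[OF S] low[of m] by auto
      then show "S \<in> {{}, {m + 2, m + 3}}" using low top[OF S] by fastforce
    next
      fix S assume "S \<in> {{}, {m + 2, m + 3}}"
      then show "S \<in> ?K" unfolding sign_changes_D_iff[OF Q] by (elim insertE) auto
    qed
    then show ?thesis using False by simp
  qed
qed

section \<open>Sweeps through all vertices\<close>

lemma D_nbrs_below_unique:
  assumes "j \<in> D_nbrs (m + 4) i" "j' \<in> D_nbrs (m + 4) i" "j < i" "j' < i"
  shows "j = j'"
  using assms by (auto simp: D_nbrs_def dynkin_D_edge_iff)

text \<open>
  The vertices are inserted one by one.  A new vertex has at most one neighbour among the previous
  ones, so it can go to the front or to the end.
\<close>

lemma topological_order: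
  assumes Q: "orientation_of (dynkin_D (m + 4)) Q"
  shows "\<exists>L. distinct L \<and> set L = {..<i} \<and> sorted_wrt (\<lambda>a b. (b, a) \<notin> Q) L"
proof (induction i)
  case (Suc i)
  then obtain L where L: "distinct L" "set L = {..<i}" "sorted_wrt (\<lambda>a b. (b, a) \<notin> Q) L" by blast
  note N = D_nbrs_orientation[OF Q]
  show ?case
  proof (cases "\<exists>j<i. (i, j) \<in> Q")
    case True
    then obtain j where j: "j < i" "(i, j) \<in> Q" by blast
    have "(y, i) \<notin> Q" if "y < i" for y
      using D_nbrs_below_unique[of j m i y] j that N by blast
    then have "sorted_wrt (\<lambda>a b. (b, a) \<notin> Q) (i # L)" using L by simp
    moreover have "distinct (i # L)" "set (i # L) = {..<Suc i}" using L(1,2) by (auto simp: lessThan_Suc)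
    ultimately show ?thesis by (intro exI conjI)
  next
    case False
    then have "sorted_wrt (\<lambda>a b. (b, a) \<notin> Q) (L @ [i])" using L by (simp add: sorted_wrt_append)
    moreover have "distinct (L @ [i])" "set (L @ [i]) = {..<Suc i}" using L(1,2) by (auto simp: lessThan_Suc)
    ultimately show ?thesis by (intro exI conjI)
  qed
qed simp

text \<open>
  The exchange matrix after reversing the arrows between \<open>A\<close> and its complement, which is the effect
  of mutating each vertex of \<open>A\<close> once as a source.
\<close>

definition partially_flipped :: "(nat \<times> nat) set \<Rightarrow> nat set \<Rightarrow> exchange_matrix" where
  "partially_flipped Q A i j = (if i \<in> A \<longleftrightarrow> j \<in> A then exchange_matrix_of Q i j else - exchange_matrix_of Q i j)"

text \<open>
  In topological order every vertex is a source when its turn comes, so one of its exchange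
  monomials is 1 and the other one is the product over all its neighbours.  Those with an arrow to it
  have already been mutated, the others have not.
\<close>

lemma partial_sweep:
  assumes Q: "orientation_of (dynkin_D (m + 4)) Q"
    and x: "(x, exchange_matrix_of Q) \<in> seeds (m + 4) Q"
  shows "distinct (L @ L') \<Longrightarrow> set (L @ L') = {..<m + 4} \<Longrightarrow> sorted_wrt (\<lambda>a b. (b, a) \<notin> Q) (L @ L') \<Longrightarrow>
    \<exists>y. (y, partially_flipped Q (set L)) \<in> seeds (m + 4) Q \<and> (\<forall>i. i \<notin> set L \<longrightarrow> y i = x i) \<and>
      (\<forall>f\<in>nonzero_friezes (m + 4) Q. \<forall>i\<in>set L. f (x i) * f (y i) =
        1 + (\<Prod>j\<in>D_nbrs (m + 4) i. f ((if (j, i) \<in> Q then y else x) j)))"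
proof (induction L arbitrary: L' rule: rev_induct)
  case Nil
  have "partially_flipped Q {} = exchange_matrix_of Q" by (intro ext) (simp add: partially_flipped_def)
  then show ?case using x by auto
next
  case (snoc v L)
  let ?k = "m + 4" and ?b = "partially_flipped Q (set L)"
  have "\<exists>y. (y, ?b) \<in> seeds ?k Q \<and> (\<forall>i. i \<notin> set L \<longrightarrow> y i = x i) \<and>
      (\<forall>f\<in>nonzero_friezes ?k Q. \<forall>i\<in>set L. f (x i) * f (y i) =
        1 + (\<Prod>j\<in>D_nbrs ?k i. f ((if (j, i) \<in> Q then y else x) j)))"
    by (rule snoc.IH[of "v # L'"]) (use snoc.prems in simp_all)
  then obtain y where y: "(y, ?b) \<in> seeds ?k Q" "\<forall>i. i \<notin> set L \<longrightarrow> y i = x i"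
    and rel: "\<forall>f\<in>nonzero_friezes ?k Q. \<forall>i\<in>set L. f (x i) * f (y i) =
        1 + (\<Prod>j\<in>D_nbrs ?k i. f ((if (j, i) \<in> Q then y else x) j))"
    by (elim exE conjE)
  note N = D_nbrs_orientation[OF Q]
  have v: "v < ?k" "v \<notin> set L" using snoc.prems by auto
  have vv: "(v, v) \<notin> Q" using N(2) by blast
  have before: "(v, i) \<notin> Q" if "i \<in> set L" for i
    using snoc.prems(3) that by (simp add: sorted_wrt_append)
  have after: "(i, v) \<notin> Q" if "i \<notin> set L" for i
  proof
    assume iv: "(i, v) \<in> Q"
    then have "i \<in> D_nbrs ?k v" using N(1) by blast
    then have "i < ?k" using D_nbrs_less by blast
    then have "i \<in> set L' \<or> i = v" using snoc.prems(2) that by auto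
    then show False using snoc.prems(3) iv vv by (auto simp: sorted_wrt_append)
  qed
  have source: "?b i v = - of_bool (i \<in> D_nbrs ?k v)" "?b v i = of_bool (i \<in> D_nbrs ?k v)" for i
    using before[of i] after[of i] v(2) N[of i v] N[of v i]
    by (auto simp: partially_flipped_def exchange_matrix_of_def)
  define y' where "y' = mutate_cluster ?k v ?b y"
  have y'_other: "y' i = y i" if "i \<noteq> v" for i
    using that by (simp add: y'_def mutate_cluster_other)
  have "mutate_matrix v ?b = partially_flipped Q (set (L @ [v]))"
  proof (intro ext)
    fix i j
    have "exchange_matrix_of Q v v = 0" using vv by (simp add: exchange_matrix_of_def)
    then show "mutate_matrix v ?b i j = partially_flipped Q (set (L @ [v])) i j"
      unfolding mutate_matrix_def source using v(2) by (auto simp: partially_flipped_def)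
  qed
  then have seed: "(y', partially_flipped Q (set (L @ [v]))) \<in> seeds ?k Q"
    using seeds.mutate[OF y(1) v(1)] by (simp add: y'_def)
  have "f (x i) * f (y' i) = 1 + (\<Prod>j\<in>D_nbrs ?k i. f ((if (j, i) \<in> Q then y' else x) j))"
    if f: "f \<in> nonzero_friezes ?k Q" and i: "i \<in> set (L @ [v])" for f i
  proof (cases "i = v")
    case True
    have "f (y v) * f (y' v) = 1 + (\<Prod>j<?k. f (y j) ^ of_bool (j \<in> D_nbrs ?k v))"
      unfolding y'_def frieze_exchange[OF f y(1) v(1)] source by (simp add: of_bool_def if_distrib cong: if_cong)
    also have "(\<Prod>j<?k. f (y j) ^ of_bool (j \<in> D_nbrs ?k v)) = (\<Prod>j\<in>D_nbrs ?k v. f (y j))"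
      by (intro prod.mono_neutral_cong_right) (auto dest: D_nbrs_less)
    also have "\<dots> = (\<Prod>j\<in>D_nbrs ?k v. f ((if (j, v) \<in> Q then y' else x) j))"
    proof (intro prod.cong refl)
      fix j assume j: "j \<in> D_nbrs ?k v"
      then have "j \<noteq> v" using N vv by blast
      moreover have "j \<notin> set L" if "(j, v) \<notin> Q" using that j before N(1) by blast
      ultimately show "f (y j) = f ((if (j, v) \<in> Q then y' else x) j)"
        using y'_other y(2) by simp
    qed
    finally show ?thesis using True y(2)[rule_format, OF v(2)] by simp
  next
    case False
    then have iL: "i \<in> set L" using i by simp
    have "(\<Prod>j\<in>D_nbrs ?k i. f ((if (j, i) \<in> Q then y else x) j)) = (\<Prod>j\<in>D_nbrs ?k i. f ((if (j, i) \<in> Q then y' else x) j))"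
    proof (intro prod.cong refl)
      show "f ((if (j, i) \<in> Q then y else x) j) = f ((if (j, i) \<in> Q then y' else x) j)" for j
        using before[OF iL] y'_other[of j] by (cases "j = v") simp_all
    qed
    then show ?thesis using rel[rule_format, OF f iL] y'_other[OF False] by simp
  qed
  moreover have "y' i = x i" if "i \<notin> set (L @ [v])" for i
    using that y'_other y(2) by simp
  ultimately show ?case using seed by blast
qed

lemma sweep:
  assumes Q: "orientation_of (dynkin_D (m + 4)) Q"
    and x: "(x, exchange_matrix_of Q) \<in> seeds (m + 4) Q"
  shows "\<exists>y. (y, exchange_matrix_of Q) \<in> seeds (m + 4) Q \<and>
      (\<forall>f\<in>nonzero_friezes (m + 4) Q. \<forall>i<m + 4. f (x i) * f (y i) =
        1 + (\<Prod>j\<in>D_nbrs (m + 4) i. f ((if (j, i) \<in> Q then y else x) j)))"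
proof -
  obtain L where L: "distinct L" "set L = {..<m + 4}" "sorted_wrt (\<lambda>a b. (b, a) \<notin> Q) L"
    using topological_order[OF Q] by blast
  have "exchange_matrix_of Q i j = 0" if "\<not> (i < m + 4 \<and> j < m + 4)" for i j
    using that D_nbrs_less[of j m i] D_nbrs_orientation(1)[OF Q, of j i]
    by (auto simp: exchange_matrix_of_def)
  then have "partially_flipped Q {..<m + 4} = exchange_matrix_of Q"
    by (intro ext) (auto simp: partially_flipped_def)
  then show ?thesis using partial_sweep[OF Q x, of L "[]"] L by auto
qed

lemma sweep_sequence:
  assumes Q: "orientation_of (dynkin_D (m + 4)) Q"
  obtains W where "\<And>t. (W t, exchange_matrix_of Q) \<in> seeds (m + 4) Q"
    "\<And>f. f \<in> nonzero_friezes (m + 4) Q \<Longrightarrow> D_mesh m Q (\<lambda>t i. f (W t i))"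
proof -
  have "\<exists>W. \<forall>t. (W t, exchange_matrix_of Q) \<in> seeds (m + 4) Q \<and>
      (\<forall>f\<in>nonzero_friezes (m + 4) Q. \<forall>i<m + 4. f (W t i) * f (W (Suc t) i) =
        1 + (\<Prod>j\<in>D_nbrs (m + 4) i. f ((if (j, i) \<in> Q then W (Suc t) else W t) j)))"
    using dependent_nat_choice[of "\<lambda>_ x. (x, exchange_matrix_of Q) \<in> seeds (m + 4) Q"
      "\<lambda>_ x y. \<forall>f\<in>nonzero_friezes (m + 4) Q. \<forall>i<m + 4. f (x i) * f (y i) =
        1 + (\<Prod>j\<in>D_nbrs (m + 4) i. f ((if (j, i) \<in> Q then y else x) j))"]
      seeds.initial sweep[OF Q] by blast
  then obtain W where W: "\<And>t. (W t, exchange_matrix_of Q) \<in> seeds (m + 4) Q"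
    "\<And>t f i. f \<in> nonzero_friezes (m + 4) Q \<Longrightarrow> i < m + 4 \<Longrightarrow> f (W t i) * f (W (Suc t) i) =
        1 + (\<Prod>j\<in>D_nbrs (m + 4) i. f ((if (j, i) \<in> Q then W (Suc t) else W t) j))"
    by blast
  have "D_mesh m Q (\<lambda>t i. f (W t i))" if f: "f \<in> nonzero_friezes (m + 4) Q" for f
  proof
    show "orientation_of (dynkin_D (m + 4)) Q" by (rule Q)
    show "f (W t i) \<noteq> 0" if "i < m + 4" for t i by (rule nonzero_friezeD(2)[OF f W(1) that])
    show "f (W t i) * f (W (Suc t) i) = 1 + (\<Prod>j\<in>D_nbrs (m + 4) i. f (W (t + of_bool ((j, i) \<in> Q)) j))"
      if "i < m + 4" for t i
      unfolding W(2)[OF f that] by (intro arg_cong[where f = "(+) 1"] prod.cong refl) simp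
  qed
  then show ?thesis using that W(1) by blast
qed

section \<open>Counting friezes\<close>

theorem theorem1p4:
  fixes k :: nat and Q :: "(nat \<times> nat) set"
  assumes "k \<ge> 4" and "orientation_of (dynkin_D k) Q"
  shows "finite (nonzero_friezes k Q) \<and> finite (positive_friezes k Q) \<and>
         card (nonzero_friezes k Q) =
           (if even k then 4 else 2) * card (positive_friezes k Q)"
proof -
  obtain m where k: "k = m + 4" using assms(1) by (metis add.commute le_Suc_ex)
  have Q: "orientation_of (dynkin_D (m + 4)) Q" using assms(2) k by simp
  obtain W where W: "\<And>t. (W t, exchange_matrix_of Q) \<in> seeds (m + 4) Q"
    and mesh: "\<And>f. f \<in> nonzero_friezes (m + 4) Q \<Longrightarrow> D_mesh m Q (\<lambda>t i. f (W t i))"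
    using sweep_sequence[OF Q] by blast
  have balanced: "\<exists>x. (x, exchange_matrix_of Q) \<in> seeds (m + 4) Q \<and>
      in_kernel (m + 4) (exchange_matrix_of Q) (\<lambda>i. neg_bit (f (x i)))"
    if f: "f \<in> nonzero_friezes (m + 4) Q" for f
  proof (intro exI conjI)
    let ?y = "\<lambda>i. f (W (late m Q) i)"
    show "(W (late m Q), exchange_matrix_of Q) \<in> seeds (m + 4) Q" by (rule W)
    show "in_kernel (m + 4) (exchange_matrix_of Q) (\<lambda>i. neg_bit (?y i))"
      unfolding in_kernel_D_iff[OF Q]
    proof (intro allI impI)
      fix i assume i: "i < m + 4"
      have "parity_sign (\<Sum>j\<in>D_nbrs (m + 4) i. neg_bit (?y j)) = (\<Prod>j\<in>D_nbrs (m + 4) i. sgn (?y j))"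
        unfolding parity_sign_sum
      proof (intro prod.cong refl)
        fix j assume "j \<in> D_nbrs (m + 4) i"
        then have "?y j \<noteq> 0" using nonzero_friezeD(2)[OF f W] D_nbrs_less by blast
        then show "parity_sign (neg_bit (?y j)) = sgn (?y j)" by (simp add: parity_sign_def sgn_if)
      qed
      then have "parity_sign (\<Sum>j\<in>D_nbrs (m + 4) i. neg_bit (?y j)) = (1 :: int)"
        using D_mesh_signs_balanced[OF mesh[OF f] i] by simp
      then show "even (\<Sum>j\<in>D_nbrs (m + 4) i. neg_bit (?y j))"
        by (simp add: parity_sign_def split: if_splits)
    qed
  qed
  have bij: "bij_betw (\<lambda>(S, f). flip_frieze k Q S f) (sign_changes k Q \<times> positive_friezes k Q) (nonzero_friezes k Q)"
    unfolding k by (rule flip_frieze_bij_betw[OF balanced])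
  obtain B where B: "\<And>Y. D_mesh m Q Y \<Longrightarrow> \<forall>t. \<forall>i<m + 4. 0 < Y t i \<Longrightarrow> \<forall>i<m + 4. Y (late m Q) i \<le> B"
    using D_mesh_positive_bounded[of m Q] by blast
  have fin: "finite (positive_friezes k Q)"
  proof (rule inj_on_finite)
    let ?r = "\<lambda>f. restrict (\<lambda>i. f (W (late m Q) i)) {..<k}"
    have mem: "0 < f (W t i)" if "f \<in> positive_friezes k Q" "i < k" for f t i
      using that cluster_variableI[OF W[folded k]] by (simp add: positive_friezes_def)
    show "inj_on ?r (positive_friezes k Q)"
    proof (rule inj_onI)
      fix f g assume f: "f \<in> positive_friezes k Q" and g: "g \<in> positive_friezes k Q" and eq: "?r f = ?r g"
      have "\<forall>i<k. f (W (late m Q) i) = g (W (late m Q) i)"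
        using fun_cong[OF eq] by (metis lessThan_iff restrict_apply')
      then show "f = g"
        using frieze_determined_by_seed[OF f[THEN positive_frieze_nonzero] g[THEN positive_frieze_nonzero] W[folded k]]
        by blast
    qed
    show "?r ` positive_friezes k Q \<subseteq> {..<k} \<rightarrow>\<^sub>E {0..B}"
    proof (intro subsetI, elim imageE)
      fix r f assume r: "r = ?r f" and f: "f \<in> positive_friezes k Q"
      have "\<forall>i<k. f (W (late m Q) i) \<le> B"
        using B[OF mesh] mem[OF f] positive_frieze_nonzero[OF f] unfolding k by blast
      then show "r \<in> {..<k} \<rightarrow>\<^sub>E {0..B}" using less_imp_le[OF mem[OF f]] unfolding r by auto
    qed
    show "finite ({..<k} \<rightarrow>\<^sub>E {0..B})" by (intro finite_PiE) auto
  qed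
  have finS: "finite (sign_changes k Q)"
    by (rule finite_subset[of _ "Pow {..<k}"]) (auto simp: sign_changes_def)
  have "card (sign_changes k Q) = (if even k then 4 else 2)"
    using card_sign_changes_D[OF Q] by (simp add: k)
  then show ?thesis
    using bij_betw_same_card[OF bij] bij_betw_finite[OF bij] fin finS
    by (simp add: card_cartesian_product)
qed

end
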